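(* Let $k\geq 2$ and $s\geq 1$ be integers and let $\alpha\in[\frac{ks+1}{ks+s},1]$ be rational. Let $\ell$ be the smallest positive integer such that $\frac{\ell}{(2k+1)s}$ and $\frac{\alpha\ell}{(2k+1)s}$ are integers. There exist integers $t_0,q_0$ such that for every integer $t\geq t_0$ and every prime power $q\geq q_0$ there exists a bipartite graph $G$ with parts $M,N$, $|M|=q^{\alpha\ell}$, $|N|=q^{\ell}$, such that $G$ is $K_{s,t}^{(2k+1)}$-free and \[e(G)\geq \frac12 |M|^{1-\frac{k}{2k+1}}|N|^{1-\frac{k}{2k+1}-\frac{1}{(2k+1)s}}.\]
   Context: For a graph $H$ and a positive integer $k$, $H^{(k)}$ is obtained from $H$ by replacing each edge $uv$ by a path of length $k$ from $u$ to $v$, these paths being pairwise internally vertex-disjoint. $K_{s,t}$ is the complete bipartite graph with parts of sizes $s$ and $t$. *)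

theory Defs
  imports Complex_Main "HOL-Number_Theory.Prime_Powers"
begin

type_synonym 'a ugraph = "'a set \<times> 'a set set"

abbreviation verts :: "'a ugraph \<Rightarrow> 'a set" where "verts \<equiv> fst"
abbreviation edges :: "'a ugraph \<Rightarrow> 'a set set" where "edges \<equiv> snd"

definition simple_graph :: "'a ugraph \<Rightarrow> bool" where
  "simple_graph G \<longleftrightarrow> finite (verts G) \<and> (\<forall>e \<in> edges G. e \<subseteq> verts G \<and> card e = 2)"

definition bipartite_graph :: "'a ugraph \<Rightarrow> 'a set \<Rightarrow> 'a set \<Rightarrow> bool" where
  "bipartite_graph G M N \<longleftrightarrow> simple_graph G \<and> verts G = M \<union> N \<and> M \<inter> N = {} \<and>
     (\<forall>e \<in> edges G. \<exists>u \<in> M. \<exists>v \<in> N. e = {u, v})"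

definition complete_bipartite :: "nat \<Rightarrow> nat \<Rightarrow> nat ugraph" where
  "complete_bipartite s t = ({..<s + t}, {{i, j} | i j. i < s \<and> s \<le> j \<and> j < s + t})"

datatype 'a subdiv_vertex = Branch 'a | Inner 'a 'a nat

text \<open>
  The \<open>i\<close>-th vertex, \<open>0 \<le> i \<le> k\<close>, of the path of length \<open>k\<close> that replaces the edge \<open>uv\<close>.
\<close>

definition subdiv_point :: "nat \<Rightarrow> 'a \<Rightarrow> 'a \<Rightarrow> nat \<Rightarrow> 'a subdiv_vertex" where
  "subdiv_point k u v i = (if i = 0 then Branch u else if i = k then Branch v else Inner u v i)"

text \<open>
  \<open>subdivision k H\<close> is the graph \<open>H\<^sup>(\<^sup>k\<^sup>)\<close>, meaningful for \<open>k \<ge> 1\<close>. The linear order on the vertices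
  of \<open>H\<close> only serves to traverse every edge in one of its two directions, so that each edge
  is replaced by a single path; up to isomorphism the result does not depend on it.
\<close>

definition subdivision :: "nat \<Rightarrow> ('a::linorder) ugraph \<Rightarrow> 'a subdiv_vertex ugraph" where
  "subdivision k H =
     (Branch ` verts H \<union> {Inner u v i | u v i. u < v \<and> {u, v} \<in> edges H \<and> 0 < i \<and> i < k},
      {{subdiv_point k u v i, subdiv_point k u v (Suc i)} | u v i.
         u < v \<and> {u, v} \<in> edges H \<and> i < k})"

text \<open>Subgraph containment: copies need not be induced.\<close>

definition contains_copy :: "'b ugraph \<Rightarrow> 'a ugraph \<Rightarrow> bool" where
  "contains_copy G F \<longleftrightarrow>
     (\<exists>\<phi>. inj_on \<phi> (verts F) \<and> \<phi> ` verts F \<subseteq> verts G \<and> (\<forall>e \<in> edges F. \<phi> ` e \<in> edges G))"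

definition graph_free :: "'b ugraph \<Rightarrow> 'a ugraph \<Rightarrow> bool" where
  "graph_free G F \<longleftrightarrow> \<not> contains_copy G F"

end

theory Submission
  imports Defs "HOL-Algebra.Algebraic_Closure_Type" "HOL-Library.Z2"
begin

text \<open>
  Take random polynomials \<open>f\<^sub>1, \<dots>, f\<^sub>r\<close> over a finite field of size comparable to \<open>q\<close> and join
  \<open>x\<close> to \<open>y\<close> when \<open>(f\<^sub>1(x, y), \<dots>, f\<^sub>r(x, y))\<close> lies in a fixed set \<open>Z\<close> of \<open>2\<^sup>r\<close> values. A copy of
  the subdivision contains \<open>t\<close> spiders with the same \<open>s\<close> roots that are otherwise disjoint, and each
  of them solves one of boundedly many polynomial systems. Boundedly many of these solutions are
  nonsingular, by an elementary form of Bezout's theorem. The singular ones are controlled by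
  probability: values and derivatives of the \<open>f\<^sub>i\<close> at distinct points are independent, and a solution
  is singular with probability \<open>O(1/q)\<close> because the spider is balanced, so a union bound over all
  roots excludes \<open>T\<close> disjoint singular solutions for a constant \<open>T\<close>.

  The field is taken in characteristic 2, inside one fixed algebraically closed type. Its order is
  then only within a factor 2 of \<open>q\<close>, which the \<open>2\<^sup>r\<close> allowed values compensate.
\<close>

hide_const (open) Divisibility.prime

section \<open>Monomials and grids\<close>

abbreviation exponents :: "'v set \<Rightarrow> nat \<Rightarrow> ('v \<Rightarrow> nat) set" where
  "exponents V d \<equiv> PiE V (\<lambda>_. {..d})"

definition monomial :: "'v set \<Rightarrow> ('v \<Rightarrow> nat) \<Rightarrow> ('v \<Rightarrow> 'a) \<Rightarrow> 'a::comm_semiring_1" where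
  "monomial V a x = (\<Prod>i\<in>V. x i ^ a i)"

lemma monomial_insert:
  "finite V \<Longrightarrow> i \<notin> V \<Longrightarrow> monomial (insert i V) a x = x i ^ a i * monomial V a x"
  by (simp add: monomial_def)

lemma monomial_cong:
  "(\<And>i. i \<in> V \<Longrightarrow> a i = b i) \<Longrightarrow> (\<And>i. i \<in> V \<Longrightarrow> x i = y i) \<Longrightarrow> monomial V a x = monomial V b y"
  by (simp add: monomial_def)

lemma monomial_add: "monomial V (\<lambda>i. a i + b i) x = monomial V a x * monomial V b x"
  by (simp add: monomial_def power_add prod.distrib)

lemma card_exponents: "finite V \<Longrightarrow> card (exponents V d) = (d + 1) ^ card V"
  by (simp add: card_PiE)

lemma power_sum_zero_imp_coeff_zero:
  fixes c :: "nat \<Rightarrow> 'a::idom"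
  assumes "card Y > \<delta>" and "\<And>y. y \<in> Y \<Longrightarrow> (\<Sum>i\<le>\<delta>. c i * y ^ i) = 0" and "i \<le> \<delta>"
  shows "c i = 0"
proof -
  define p where "p = (\<Sum>i\<le>\<delta>. monom (c i) i)"
  have coeff_p: "coeff p i = (if i \<le> \<delta> then c i else 0)" for i
    by (simp add: p_def coeff_sum)
  then have "degree p \<le> \<delta>" by (intro degree_le) auto
  then have "p = 0"
    by (intro poly_eqI_degree[of Y]) (use assms in \<open>auto simp: p_def poly_sum poly_monom\<close>)
  then show ?thesis using coeff_p[of i] assms(3) by simp
qed

lemma sum_exponents_insert:
  fixes C :: "('v \<Rightarrow> nat) \<Rightarrow> 'a::comm_semiring_1"
  assumes "finite V" "j \<notin> V"
  shows "(\<Sum>a\<in>exponents (insert j V) d. C a * monomial (insert j V) a (y(j := t))) =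
    (\<Sum>i\<le>d. (\<Sum>b\<in>exponents V d. C (b(j := i)) * monomial V b y) * t ^ i)"
proof -
  have inj: "inj_on (\<lambda>(i, b). b(j := i)) ({..d} \<times> exponents V d)"
    using assms(2) by (auto simp: inj_on_def fun_eq_iff PiE_def extensional_def)
  have monomial_upd: "monomial (insert j V) (b(j := i)) (y(j := t)) = t ^ i * monomial V b y" for i b
  proof -
    have "monomial V (b(j := i)) (y(j := t)) = monomial V b y"
      using assms(2) by (intro monomial_cong) auto
    then show ?thesis using assms by (simp add: monomial_insert)
  qed
  have "(\<Sum>a\<in>exponents (insert j V) d. C a * monomial (insert j V) a (y(j := t))) =
      (\<Sum>(i, b)\<in>{..d} \<times> exponents V d. C (b(j := i)) * (t ^ i * monomial V b y))"
    unfolding PiE_insert_eq by (subst sum.reindex[OF inj]) (simp add: case_prod_unfold monomial_upd)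
  also have "\<dots> = (\<Sum>i\<le>d. (\<Sum>b\<in>exponents V d. C (b(j := i)) * monomial V b y) * t ^ i)"
    unfolding sum.cartesian_product[symmetric] sum_distrib_right
    by (intro sum.cong refl) (simp add: mult_ac)
  finally show ?thesis .
qed

lemma vanishing_on_grid_imp_coeff_zero:
  fixes C :: "('v \<Rightarrow> nat) \<Rightarrow> 'a::idom"
  assumes "finite V" and "\<And>i. i \<in> V \<Longrightarrow> card (Y i) > \<delta>"
    and "\<And>y. y \<in> PiE V Y \<Longrightarrow> (\<Sum>a\<in>exponents V \<delta>. C a * monomial V a y) = 0"
    and "a \<in> exponents V \<delta>"
  shows "C a = 0"
  using assms
proof (induction V arbitrary: C a rule: finite_induct)
  case empty
  then show ?case by (simp add: monomial_def)
next
  case (insert j V)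
  have "(\<Sum>b\<in>exponents V \<delta>. C (b(j := a j)) * monomial V b y) = 0" if y: "y \<in> PiE V Y" for y
  proof (rule power_sum_zero_imp_coeff_zero[where i = "a j"])
    show "card (Y j) > \<delta>" using insert.prems(1) by blast
    show "(\<Sum>i\<le>\<delta>. (\<Sum>b\<in>exponents V \<delta>. C (b(j := i)) * monomial V b y) * t ^ i) = 0"
      if "t \<in> Y j" for t
      using insert.prems(2)[OF PiE_fun_upd[OF that y]]
      by (simp only: sum_exponents_insert[OF insert.hyps])
    show "a j \<le> \<delta>" using insert.prems(3) by (auto dest: PiE_mem)
  qed
  then have "C ((a(j := undefined))(j := a j)) = 0"
    using insert.prems(1) fun_upd_in_PiE[OF insert.hyps(2) insert.prems(3)]
    by (intro insert.IH[where a = "a(j := undefined)" and C = "\<lambda>b. C (b(j := a j))"])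
       (simp_all only: insertI2)
  then show ?case by simp
qed

lemma coeff_0_monomial: "coeff (monomial V a \<pi>) 0 = monomial V a (\<lambda>i. coeff (\<pi> i) 0)"
  by (simp add: monomial_def poly_0_coeff_0[symmetric] poly_prod)

lemma coeff_monomial_lowest:
  fixes \<pi> :: "'v \<Rightarrow> 'a::comm_ring_1 poly"
  assumes K: "finite K" "J \<subseteq> K" and zero: "\<And>j. j \<in> J \<Longrightarrow> coeff (\<pi> j) 0 = 0" and m: "m \<le> sum a J"
  shows "coeff (monomial K a \<pi>) m =
    (if sum a J = m then monomial K a (\<lambda>k. coeff (\<pi> k) (if k \<in> J then 1 else 0)) else 0)"
proof -
  define \<sigma> where "\<sigma> k = (if k \<in> J then poly_shift 1 (\<pi> k) else \<pi> k)" for k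
  have factor: "\<pi> k ^ a k = (if k \<in> J then monom 1 (a k) else 1) * \<sigma> k ^ a k" for k
  proof (cases "k \<in> J")
    case True
    then have "\<pi> k = monom 1 1 * \<sigma> k"
      using zero by (intro poly_eqI) (auto simp: \<sigma>_def coeff_monom_mult coeff_poly_shift)
    then show ?thesis using True by (simp add: power_mult_distrib monom_power)
  qed (simp add: \<sigma>_def)
  have "(\<Prod>k\<in>K. if k \<in> J then monom (1::'a) (a k) else 1) = (\<Prod>j\<in>J. monom 1 (a j))"
    using K by (simp add: prod.If_cases Int_absorb1)
  also have "\<dots> = monom 1 (sum a J)"
    using finite_subset[OF K(2,1)] by (induction J rule: finite_induct) (auto simp: mult_monom)
  finally have "monomial K a \<pi> = monom 1 (sum a J) * monomial K a \<sigma>"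
    by (simp add: monomial_def factor prod.distrib)
  moreover have "coeff (\<sigma> k) 0 = coeff (\<pi> k) (if k \<in> J then 1 else 0)" for k
    by (simp add: \<sigma>_def coeff_poly_shift)
  ultimately show ?thesis
    using m by (auto simp: coeff_monom_mult coeff_0_monomial)
qed

section \<open>Polynomial functions over a finite subfield\<close>

locale finite_subfield =
  fixes F :: "'k::field set"
  assumes infinite_UNIV_k: "infinite (UNIV :: 'k set)"
    and finite_F [simp]: "finite F"
    and zero_in [simp]: "0 \<in> F"
    and one_in [simp]: "1 \<in> F"
    and add_in [simp]: "x \<in> F \<Longrightarrow> y \<in> F \<Longrightarrow> x + y \<in> F"
    and minus_in [simp]: "x \<in> F \<Longrightarrow> - x \<in> F"
    and mult_in [simp]: "x \<in> F \<Longrightarrow> y \<in> F \<Longrightarrow> x * y \<in> F"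
    and inverse_in [simp]: "x \<in> F \<Longrightarrow> inverse x \<in> F"
begin

lemma diff_in [simp]: "x \<in> F \<Longrightarrow> y \<in> F \<Longrightarrow> x - y \<in> F"
  using add_in[of x "- y"] by simp

lemma divide_in [simp]: "x \<in> F \<Longrightarrow> y \<in> F \<Longrightarrow> x / y \<in> F"
  by (simp add: divide_inverse)

lemma sum_in: "(\<And>i. i \<in> A \<Longrightarrow> f i \<in> F) \<Longrightarrow> sum f A \<in> F"
  by (induction A rule: infinite_finite_induct) auto

lemma card_F_gt_1: "card F > 1"
proof -
  have "card {0, 1 :: 'k} \<le> card F" by (intro card_mono) auto
  then show ?thesis by simp
qed

lemma card_pinned_functions:
  assumes "finite V" "C \<subseteq> V" "i \<in> C"
  shows "card (PiE V (\<lambda>w. if w = i then {1} else if w \<in> C then F else {0})) * card F =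
    card F ^ card C"
proof -
  have "card (PiE V (\<lambda>w. if w = i then {1} else if w \<in> C then F else {0})) =
      (\<Prod>w\<in>V. if w = i then 1 else if w \<in> C then card F else 1)"
    unfolding card_PiE[OF assms(1)] by (intro prod.cong) auto
  also have "\<dots> = (\<Prod>w\<in>V - {i}. if w \<in> C then card F else 1)"
    using assms by (subst prod.remove[of _ i]) (auto intro!: prod.cong)
  also have "\<dots> * card F = (\<Prod>w\<in>V. if w \<in> C then card F else 1)"
    using assms by (subst (2) prod.remove[of _ i]) auto
  also have "\<dots> = card F ^ card C"
    using assms by (simp add: prod.If_cases Int_absorb1)
  finally show ?thesis .
qed

text \<open>
  The arguments of a polynomial function range over the whole infinite field, so that its
  restrictions to lines are formal univariate polynomials although \<open>F\<close> is finite.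
\<close>

inductive poly_fun :: "'v set \<Rightarrow> nat \<Rightarrow> (('v \<Rightarrow> 'k) \<Rightarrow> 'k) \<Rightarrow> bool" for V where
  const: "c \<in> F \<Longrightarrow> poly_fun V d (\<lambda>x. c)"
| var: "i \<in> V \<Longrightarrow> d \<ge> 1 \<Longrightarrow> poly_fun V d (\<lambda>x. x i)"
| add: "poly_fun V d g \<Longrightarrow> poly_fun V d h \<Longrightarrow> poly_fun V d (\<lambda>x. g x + h x)"
| mult: "poly_fun V d g \<Longrightarrow> poly_fun V e h \<Longrightarrow> d + e \<le> d' \<Longrightarrow> poly_fun V d' (\<lambda>x. g x * h x)"

lemma poly_fun_mono: "poly_fun V d g \<Longrightarrow> d \<le> d' \<Longrightarrow> poly_fun V d' g"
proof (induction arbitrary: d' rule: poly_fun.induct)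
  case (mult d g e h d'' d')
  show ?case by (rule poly_fun.mult[OF mult(1,2)]) (use mult in linarith)
qed (auto intro: poly_fun.intros)

lemma poly_fun_sum:
  "(\<And>i. i \<in> A \<Longrightarrow> poly_fun V d (g i)) \<Longrightarrow> poly_fun V d (\<lambda>x. \<Sum>i\<in>A. g i x)"
  by (induction A rule: infinite_finite_induct) (auto intro: poly_fun.intros)

lemma poly_fun_power: "poly_fun V d g \<Longrightarrow> poly_fun V (n * d) (\<lambda>x. g x ^ n)"
  by (induction n) (auto intro: poly_fun.const poly_fun.mult[OF _ _ order_refl])

lemma poly_fun_monomial:
  assumes "\<And>k. k \<in> K \<Longrightarrow> poly_fun V d (g k)"
  shows "poly_fun V (sum a K * d) (\<lambda>x. monomial K a (\<lambda>k. g k x))"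
  unfolding monomial_def using assms
  by (induction K rule: infinite_finite_induct)
     (auto simp: add_mult_distrib
        intro: poly_fun.const poly_fun.mult[OF poly_fun_power _ order_refl])

lemma poly_fun_scale: "poly_fun V d g \<Longrightarrow> c \<in> F \<Longrightarrow> poly_fun V d (\<lambda>x. c * g x)"
  by (rule poly_fun.mult[where d = 0]) (auto intro: poly_fun.intros)

lemma poly_fun_diff: "poly_fun V d g \<Longrightarrow> poly_fun V d h \<Longrightarrow> poly_fun V d (\<lambda>x. g x - h x)"
  using poly_fun.add[of V d g "\<lambda>x. (- 1) * h x"] poly_fun_scale[of V d h "- 1"] by simp

lemma poly_fun_cong: "poly_fun V d g \<Longrightarrow> (\<And>i. i \<in> V \<Longrightarrow> x i = y i) \<Longrightarrow> g x = g y"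
  by (induction rule: poly_fun.induct) auto

lemma poly_fun_in: "poly_fun V d g \<Longrightarrow> (\<And>i. i \<in> V \<Longrightarrow> x i \<in> F) \<Longrightarrow> g x \<in> F"
  by (induction rule: poly_fun.induct) auto

lemma poly_fun_subst:
  assumes "poly_fun W d g"
    and "\<And>w. w \<in> W \<Longrightarrow> (\<exists>i\<in>V. \<sigma> w = (\<lambda>x. x i)) \<or> (\<exists>c\<in>F. \<sigma> w = (\<lambda>x. c))"
  shows "poly_fun V d (\<lambda>x. g (\<lambda>w. \<sigma> w x))"
  using assms(1)
proof (induction rule: poly_fun.induct)
  case (var i d)
  then show ?case
    using assms(2)[of i] poly_fun.var[of _ V d] poly_fun.const[of _ V d] by auto
qed (auto intro: poly_fun.intros)

definition monomial_combination :: "'v set \<Rightarrow> nat \<Rightarrow> (('v \<Rightarrow> nat) \<Rightarrow> 'k) \<Rightarrow> ('v \<Rightarrow> 'k) \<Rightarrow> 'k" where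
  "monomial_combination V d c x = (\<Sum>a\<in>exponents V d. c a * monomial V a x)"

abbreviation monomial_combinations :: "'v set \<Rightarrow> nat \<Rightarrow> (('v \<Rightarrow> 'k) \<Rightarrow> 'k) set" where
  "monomial_combinations V d \<equiv> monomial_combination V d ` PiE (exponents V d) (\<lambda>_. F)"

lemma monomial_combinationI:
  "(\<And>a. a \<in> exponents V d \<Longrightarrow> c a \<in> F) \<Longrightarrow> (\<And>x. g x = (\<Sum>a\<in>exponents V d. c a * monomial V a x))
    \<Longrightarrow> g \<in> monomial_combinations V d"
  by (rule image_eqI[of _ _ "restrict c (exponents V d)"])
     (auto simp: monomial_combination_def)

lemma monomial_in_combinations:
  assumes "finite V" "c \<in> F" "a \<in> exponents V d"
  shows "(\<lambda>x. c * monomial V a x) \<in> monomial_combinations V d"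
proof (rule monomial_combinationI[of _ _ "\<lambda>b. if b = a then c else 0"])
  have "finite (exponents V d)" using assms(1) by (intro finite_PiE) auto
  then show "c * monomial V a x =
      (\<Sum>b\<in>exponents V d. (if b = a then c else 0) * monomial V b x)" for x
    using assms(3) by (simp add: if_distrib[of "\<lambda>t. t * _"] sum.delta cong: if_cong)
qed (use assms in auto)

lemma add_in_combinations:
  assumes "g \<in> monomial_combinations V d" "h \<in> monomial_combinations V d"
  shows "(\<lambda>x. g x + h x) \<in> monomial_combinations V d"
proof -
  obtain b c where b: "b \<in> PiE (exponents V d) (\<lambda>_. F)" "g = monomial_combination V d b"
    and c: "c \<in> PiE (exponents V d) (\<lambda>_. F)" "h = monomial_combination V d c"
    using assms by blast
  show ?thesis
    using PiE_mem[OF b(1)] PiE_mem[OF c(1)] unfolding b(2) c(2)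
    by (intro monomial_combinationI[of _ _ "\<lambda>a. b a + c a"])
       (simp_all add: monomial_combination_def sum.distrib ring_distribs)
qed

lemma sum_in_combinations:
  "(\<And>i. i \<in> A \<Longrightarrow> g i \<in> monomial_combinations V d) \<Longrightarrow> (\<lambda>x. \<Sum>i\<in>A. g i x) \<in> monomial_combinations V d"
proof (induction A rule: infinite_finite_induct)
  case (insert i A)
  then show ?case using add_in_combinations[of "g i" V d] by simp
qed (auto intro!: monomial_combinationI[of _ _ "\<lambda>_. 0"])

lemma mult_in_combinations:
  assumes "finite V" and "g \<in> monomial_combinations V d" "h \<in> monomial_combinations V e"
    and "d + e \<le> d'"
  shows "(\<lambda>x. g x * h x) \<in> monomial_combinations V d'"
proof -
  obtain b c where b: "b \<in> PiE (exponents V d) (\<lambda>_. F)" "g = monomial_combination V d b"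
    and c: "c \<in> PiE (exponents V e) (\<lambda>_. F)" "h = monomial_combination V e c"
    using assms(2,3) by blast
  let ?add = "\<lambda>a a'. \<lambda>i\<in>V. a i + a' i :: nat"
  have "monomial V (?add a a') x = monomial V a x * monomial V a' x" for a a' and x :: "_ \<Rightarrow> 'k"
    unfolding monomial_add[symmetric] by (rule monomial_cong) auto
  then have "g x * h x =
      (\<Sum>a\<in>exponents V d. \<Sum>a'\<in>exponents V e. (b a * c a') * monomial V (?add a a') x)" for x
    unfolding b(2) c(2) monomial_combination_def sum_product
    by (intro sum.cong refl) (simp add: mult_ac)
  moreover have "(\<lambda>x. (b a * c a') * monomial V (?add a a') x) \<in> monomial_combinations V d'"
    if "a \<in> exponents V d" "a' \<in> exponents V e" for a a'
  proof (rule monomial_in_combinations)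
    have "a i + a' i \<le> d'" if "i \<in> V" for i
      using PiE_mem[OF \<open>a \<in> _\<close> that] PiE_mem[OF \<open>a' \<in> _\<close> that] assms(4) by simp
    then show "?add a a' \<in> exponents V d'" by auto
    show "b a * c a' \<in> F" using PiE_mem[OF b(1)] PiE_mem[OF c(1)] that by simp
  qed fact
  ultimately show ?thesis by (simp add: sum_in_combinations)
qed

lemma poly_fun_in_combinations:
  assumes V: "finite V" and "poly_fun V d g"
  shows "g \<in> monomial_combinations V d"
  using assms(2)
proof (induction rule: poly_fun.induct)
  case (const c d)
  then have "(\<lambda>x. c * monomial V (\<lambda>i\<in>V. 0) x) \<in> monomial_combinations V d"
    by (intro monomial_in_combinations V) auto
  then show ?case by (simp add: monomial_def)
next
  case (var j d)
  then have "(\<lambda>x. 1 * monomial V (\<lambda>i\<in>V. of_bool (i = j)) x) \<in> monomial_combinations V d"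
    by (intro monomial_in_combinations V) auto
  moreover have "monomial V (\<lambda>i\<in>V. of_bool (i = j)) x = x j" for x :: "_ \<Rightarrow> 'k"
  proof -
    have "monomial V (\<lambda>i\<in>V. of_bool (i = j)) x = (\<Prod>i\<in>V. if i = j then x i else 1)"
      unfolding monomial_def by (rule prod.cong) auto
    then show ?thesis using V var by simp
  qed
  ultimately show ?case by simp
qed (auto intro: add_in_combinations mult_in_combinations V)

abbreviation poly_funs :: "'v set \<Rightarrow> nat \<Rightarrow> (('v \<Rightarrow> 'k) \<Rightarrow> 'k) set" where
  "poly_funs V d \<equiv> {g. poly_fun V d g}"

lemma
  assumes V: "finite V"
  shows finite_poly_funs: "finite (poly_funs V d)"
    and card_poly_funs_le: "card (poly_funs V d) \<le> card F ^ ((d + 1) ^ card V)"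
proof -
  let ?C = "PiE (exponents V d) (\<lambda>_. F)"
  have fin: "finite (exponents V d)" by (intro finite_PiE V) auto
  have subset: "poly_funs V d \<subseteq> monomial_combination V d ` ?C"
    using poly_fun_in_combinations[OF V] by blast
  have fin_C: "finite ?C" by (intro finite_PiE fin) auto
  show "finite (poly_funs V d)" using subset fin_C by (meson finite_imageI finite_subset)
  have "card (poly_funs V d) \<le> card ?C" using surj_card_le[OF fin_C subset] .
  also have "\<dots> = card F ^ ((d + 1) ^ card V)" using V fin by (simp add: card_PiE card_exponents)
  finally show "card (poly_funs V d) \<le> card F ^ ((d + 1) ^ card V)" .
qed

lemma card_poly_funs_gt_0: "finite V \<Longrightarrow> card (poly_funs V d) > 0"
  using finite_poly_funs[of V d] poly_fun.const[OF zero_in] by (auto simp: card_gt_0_iff)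

section \<open>Directional derivatives\<close>

text \<open>Junk if the restriction of \<open>g\<close> to the line is not given by a polynomial.\<close>

definition dir_deriv :: "(('v \<Rightarrow> 'k) \<Rightarrow> 'k) \<Rightarrow> ('v \<Rightarrow> 'k) \<Rightarrow> ('v \<Rightarrow> 'k) \<Rightarrow> 'k" where
  "dir_deriv g p v = coeff (THE \<pi>. \<forall>\<tau>. poly \<pi> \<tau> = g (\<lambda>i. p i + \<tau> * v i)) 1"

lemma poly_ext:
  fixes \<pi> \<pi>' :: "'k poly"
  assumes "\<And>\<tau>. poly \<pi> \<tau> = poly \<pi>' \<tau>"
  shows "\<pi> = \<pi>'"
proof (rule ccontr)
  assume "\<pi> \<noteq> \<pi>'"
  then have "finite {x. poly (\<pi> - \<pi>') x = 0}" by (intro poly_roots_finite) auto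
  moreover have "{x. poly (\<pi> - \<pi>') x = 0} = UNIV" using assms by auto
  ultimately show False using infinite_UNIV_k by simp
qed

lemma dir_deriv_eq_coeff:
  assumes "\<And>\<tau>. g (\<lambda>i. p i + \<tau> * v i) = poly \<pi> \<tau>"
  shows "dir_deriv g p v = coeff \<pi> 1"
proof -
  have "(THE \<pi>. \<forall>\<tau>. poly \<pi> \<tau> = g (\<lambda>i. p i + \<tau> * v i)) = \<pi>"
    by (rule the_equality) (use assms in \<open>auto intro: poly_ext\<close>)
  then show ?thesis by (simp add: dir_deriv_def)
qed

lemma poly_fun_line:
  assumes "poly_fun V d g"
  shows "\<exists>\<pi>. (\<forall>\<tau>. g (\<lambda>i. p i + \<tau> * v i) = poly \<pi> \<tau>) \<and>
    coeff \<pi> 0 = g p \<and> coeff \<pi> 1 = dir_deriv g p v"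
proof -
  have "\<exists>\<pi>. \<forall>\<tau>. g (\<lambda>i. p i + \<tau> * v i) = poly \<pi> \<tau>"
    using assms
  proof (induction rule: poly_fun.induct)
    case (const c d)
    show ?case by (rule exI[of _ "[:c:]"]) simp
  next
    case (var i d)
    show ?case by (rule exI[of _ "[:p i, v i:]"]) simp
  next
    case (add d g h)
    then show ?case by (metis poly_add)
  next
    case (mult d g e h d')
    then show ?case by (metis poly_mult)
  qed
  then obtain \<pi> where \<pi>: "\<And>\<tau>. g (\<lambda>i. p i + \<tau> * v i) = poly \<pi> \<tau>" by blast
  show ?thesis
    by (rule exI[of _ \<pi>]) (use \<pi> \<pi>[of 0] dir_deriv_eq_coeff[OF \<pi>] in \<open>auto simp: poly_0_coeff_0\<close>)
qed

lemma dir_deriv_const: "dir_deriv (\<lambda>x. c) p v = 0"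
  by (subst dir_deriv_eq_coeff[of _ _ _ "[:c:]"]) auto

lemma dir_deriv_var: "dir_deriv (\<lambda>x. x i) p v = v i"
  by (subst dir_deriv_eq_coeff[of _ _ _ "[:p i, v i:]"]) auto

lemma dir_deriv_add:
  assumes "poly_fun V d g" "poly_fun W e h"
  shows "dir_deriv (\<lambda>x. g x + h x) p v = dir_deriv g p v + dir_deriv h p v"
proof -
  obtain \<pi> where "\<And>\<tau>. g (\<lambda>i. p i + \<tau> * v i) = poly \<pi> \<tau>" "coeff \<pi> 1 = dir_deriv g p v"
    using poly_fun_line[OF assms(1)] by blast
  moreover obtain \<pi>' where "\<And>\<tau>. h (\<lambda>i. p i + \<tau> * v i) = poly \<pi>' \<tau>" "coeff \<pi>' 1 = dir_deriv h p v"
    using poly_fun_line[OF assms(2)] by blast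
  ultimately show ?thesis by (subst dir_deriv_eq_coeff[of _ _ _ "\<pi> + \<pi>'"]) auto
qed

lemma dir_deriv_mult:
  assumes "poly_fun V d g" "poly_fun W e h"
  shows "dir_deriv (\<lambda>x. g x * h x) p v = g p * dir_deriv h p v + h p * dir_deriv g p v"
proof -
  obtain \<pi> where
    "\<And>\<tau>. g (\<lambda>i. p i + \<tau> * v i) = poly \<pi> \<tau>" "coeff \<pi> 0 = g p" "coeff \<pi> 1 = dir_deriv g p v"
    using poly_fun_line[OF assms(1)] by blast
  moreover obtain \<pi>' where
    "\<And>\<tau>. h (\<lambda>i. p i + \<tau> * v i) = poly \<pi>' \<tau>" "coeff \<pi>' 0 = h p" "coeff \<pi>' 1 = dir_deriv h p v"
    using poly_fun_line[OF assms(2)] by blast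
  ultimately show ?thesis
    by (subst dir_deriv_eq_coeff[of _ _ _ "\<pi> * \<pi>'"]) (auto simp: coeff_mult mult_ac)
qed

lemma dir_deriv_diff_const:
  assumes "poly_fun V d g"
  shows "dir_deriv (\<lambda>x. g x - c) p v = dir_deriv g p v"
proof -
  obtain \<pi> where "\<And>\<tau>. g (\<lambda>i. p i + \<tau> * v i) = poly \<pi> \<tau>" "coeff \<pi> 1 = dir_deriv g p v"
    using poly_fun_line[OF assms] by blast
  then show ?thesis by (subst dir_deriv_eq_coeff[of _ _ _ "\<pi> - [:c:]"]) auto
qed

definition partial_deriv :: "(('v \<Rightarrow> 'k) \<Rightarrow> 'k) \<Rightarrow> ('v \<Rightarrow> 'k) \<Rightarrow> 'v \<Rightarrow> 'k" where
  "partial_deriv g p i = dir_deriv g p (\<lambda>j. of_bool (j = i))"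

lemma dir_deriv_eq_sum_partial:
  assumes V: "finite V" and "poly_fun V d g"
  shows "dir_deriv g p v = (\<Sum>i\<in>V. partial_deriv g p i * v i)"
  using assms(2)
proof (induction rule: poly_fun.induct)
  case (const c d)
  then show ?case by (simp add: partial_deriv_def dir_deriv_const)
next
  case (var j d)
  have "(\<Sum>i\<in>V. of_bool (j = i) * v i) = v j"
    using V var by (simp add: of_bool_def if_distrib[of "\<lambda>t. t * _"] cong: if_cong)
  then show ?case by (simp add: partial_deriv_def dir_deriv_var)
next
  case (add d g h)
  then show ?case
    by (simp add: partial_deriv_def dir_deriv_add[OF add(1,2)] sum.distrib ring_distribs)
next
  case (mult d g e h d')
  then show ?case
    by (simp add: partial_deriv_def dir_deriv_mult[OF mult(1,2)] sum.distrib sum_distrib_left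
        ring_distribs mult_ac)
qed

lemma dir_deriv_in:
  assumes "poly_fun V d g" "\<And>i. i \<in> V \<Longrightarrow> p i \<in> F" "\<And>i. i \<in> V \<Longrightarrow> v i \<in> F"
  shows "dir_deriv g p v \<in> F"
  using assms(1)
proof (induction rule: poly_fun.induct)
  case (mult d g e h d')
  then show ?case
    using poly_fun_in[of V _ _ p] assms(2) by (simp add: dir_deriv_mult[OF mult(1,2)])
qed (simp_all add: dir_deriv_const dir_deriv_var dir_deriv_add assms(3))

lemma dir_deriv_cong:
  assumes "poly_fun V d g" "\<And>i. i \<in> V \<Longrightarrow> p i = p' i" "\<And>i. i \<in> V \<Longrightarrow> v i = v' i"
  shows "dir_deriv g p v = dir_deriv g p' v'"
proof -
  have "g (\<lambda>i. p i + \<tau> * v i) = g (\<lambda>i. p' i + \<tau> * v' i)" for \<tau>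
    by (rule poly_fun_cong[OF assms(1)]) (use assms in auto)
  then show ?thesis by (simp add: dir_deriv_def)
qed

lemma dir_deriv_linear_combination:
  assumes "finite V" "poly_fun V d g"
  shows "dir_deriv g p (\<lambda>i. \<Sum>j\<in>J. t j * v j i) = (\<Sum>j\<in>J. t j * dir_deriv g p (v j))"
  unfolding dir_deriv_eq_sum_partial[OF assms] sum_distrib_left
  by (subst sum.swap) (simp add: mult_ac)

lemma dir_deriv_scale:
  assumes "finite V" "poly_fun V d g"
  shows "dir_deriv g p (\<lambda>i. t * v i) = t * dir_deriv g p v"
  using dir_deriv_linear_combination[OF assms, where J = "{()}" and t = "\<lambda>_. t" and v = "\<lambda>_. v"]
  by simp

lemma dir_deriv_diff_direction:
  assumes "finite V" "poly_fun V d g"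
  shows "dir_deriv g p (\<lambda>i. v i - w i) = dir_deriv g p v - dir_deriv g p w"
  unfolding dir_deriv_eq_sum_partial[OF assms] by (simp add: right_diff_distrib sum_subtractf)

section \<open>Nonsingular zeros of polynomial systems\<close>

definition nonsingular :: "'v set \<Rightarrow> 'j set \<Rightarrow> ('j \<Rightarrow> ('v \<Rightarrow> 'k) \<Rightarrow> 'k) \<Rightarrow> ('v \<Rightarrow> 'k) \<Rightarrow> bool" where
  "nonsingular V J g p \<longleftrightarrow>
    (\<forall>v \<in> PiE V (\<lambda>_. F). (\<forall>j\<in>J. dir_deriv (g j) p v = 0) \<longrightarrow> (\<forall>i\<in>V. v i = 0))"

definition nonsingular_zeros :: "'v set \<Rightarrow> 'j set \<Rightarrow> ('j \<Rightarrow> ('v \<Rightarrow> 'k) \<Rightarrow> 'k) \<Rightarrow> ('v \<Rightarrow> 'k) set" where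
  "nonsingular_zeros V J g =
    {p \<in> PiE V (\<lambda>_. F). (\<forall>j\<in>J. g j p = 0) \<and> nonsingular V J g p}"

lemma finite_nonsingular_zeros: "finite V \<Longrightarrow> finite (nonsingular_zeros V J g)"
  by (rule finite_subset[of _ "PiE V (\<lambda>_. F)"]) (auto simp: nonsingular_zeros_def finite_PiE)

abbreviation jacobian_map ::
  "'j set \<Rightarrow> ('j \<Rightarrow> ('v \<Rightarrow> 'k) \<Rightarrow> 'k) \<Rightarrow> ('v \<Rightarrow> 'k) \<Rightarrow> ('v \<Rightarrow> 'k) \<Rightarrow> 'j \<Rightarrow> 'k" where
  "jacobian_map J g p v \<equiv> \<lambda>j\<in>J. dir_deriv (g j) p v"

lemma jacobian_map_image_subset:
  assumes "\<And>j. j \<in> J \<Longrightarrow> poly_fun V d (g j)" "p \<in> PiE V (\<lambda>_. F)"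
  shows "jacobian_map J g p ` PiE V (\<lambda>_. F) \<subseteq> PiE J (\<lambda>_. F)"
proof (rule image_subsetI)
  fix v assume "v \<in> PiE V (\<lambda>_. F)"
  from PiE_mem[OF this] show "jacobian_map J g p v \<in> PiE J (\<lambda>_. F)"
    using dir_deriv_in[OF assms(1)] PiE_mem[OF assms(2)] by auto
qed

lemma inj_jacobian_map:
  assumes V: "finite V" and g: "\<And>j. j \<in> J \<Longrightarrow> poly_fun V d (g j)" and nonsing: "nonsingular V J g p"
  shows "inj_on (jacobian_map J g p) (PiE V (\<lambda>_. F))"
proof (rule inj_onI)
  fix v w assume v: "v \<in> PiE V (\<lambda>_. F)" and w: "w \<in> PiE V (\<lambda>_. F)"
    and eq: "jacobian_map J g p v = jacobian_map J g p w"
  have "dir_deriv (g j) p (\<lambda>i\<in>V. v i - w i) = 0" if "j \<in> J" for j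
  proof -
    have "dir_deriv (g j) p (\<lambda>i\<in>V. v i - w i) = dir_deriv (g j) p (\<lambda>i. v i - w i)"
      by (rule dir_deriv_cong[OF g[OF that]]) auto
    then show ?thesis
      using fun_cong[OF eq, of j] that by (simp add: dir_deriv_diff_direction[OF V g])
  qed
  moreover have "(\<lambda>i\<in>V. v i - w i) \<in> PiE V (\<lambda>_. F)" using PiE_mem[OF v] PiE_mem[OF w] by auto
  ultimately have "v i = w i" if "i \<in> V" for i
    using nonsing that unfolding nonsingular_def by fastforce
  then show "v = w" by (rule PiE_ext[OF v w])
qed

lemma jacobian_map_surj:
  assumes V: "finite V" and J: "finite J" "card J = card V"
    and g: "\<And>j. j \<in> J \<Longrightarrow> poly_fun V d (g j)"
    and p: "p \<in> PiE V (\<lambda>_. F)" and nonsing: "nonsingular V J g p"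
  shows "jacobian_map J g p ` PiE V (\<lambda>_. F) = PiE J (\<lambda>_. F)"
proof (rule card_subset_eq)
  show "finite (PiE J (\<lambda>_. F))" using J by (intro finite_PiE) auto
  show "jacobian_map J g p ` PiE V (\<lambda>_. F) \<subseteq> PiE J (\<lambda>_. F)"
    by (rule jacobian_map_image_subset[OF g p])
  show "card (jacobian_map J g p ` PiE V (\<lambda>_. F)) = card (PiE J (\<lambda>_. F))"
    using V J by (simp add: card_image[OF inj_jacobian_map[OF V g nonsing]] card_PiE)
qed

lemma nonsingular_cong:
  "(\<And>j v. j \<in> J \<Longrightarrow> dir_deriv (g j) p v = dir_deriv (h j) p v) \<Longrightarrow>
    nonsingular V J g p \<longleftrightarrow> nonsingular V J h p"
  by (simp add: nonsingular_def)

lemma singular_kernel_vector: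
  assumes V: "finite V" and g: "\<And>j. j \<in> J \<Longrightarrow> poly_fun V d (g j)" and "\<not> nonsingular V J g p"
  shows "\<exists>v\<in>PiE V (\<lambda>_. F). (\<exists>i\<in>V. v i = 1) \<and> (\<forall>j\<in>J. dir_deriv (g j) p v = 0)"
proof -
  obtain v i where v: "v \<in> PiE V (\<lambda>_. F)" "i \<in> V" "v i \<noteq> 0" "\<And>j. j \<in> J \<Longrightarrow> dir_deriv (g j) p v = 0"
    using assms(3) by (auto simp: nonsingular_def)
  define v' where "v' = (\<lambda>k\<in>V. inverse (v i) * v k)"
  have "dir_deriv (g j) p v' = 0" if "j \<in> J" for j
  proof -
    have "dir_deriv (g j) p v' = dir_deriv (g j) p (\<lambda>k. inverse (v i) * v k)"
      by (rule dir_deriv_cong[OF g[OF that]]) (auto simp: v'_def)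
    then show ?thesis using v(4)[OF that] by (simp add: dir_deriv_scale[OF V g[OF that]])
  qed
  moreover have "v' \<in> PiE V (\<lambda>_. F)" "v' i = 1"
    using v(2,3) PiE_mem[OF v(1)] by (auto simp: v'_def)
  ultimately show ?thesis using v(2) by blast
qed

lemma card_le_card_nonsingular:
  assumes V: "finite V" and J: "finite J" and g: "\<And>j. j \<in> J \<Longrightarrow> poly_fun V d (g j)"
    and p: "p \<in> PiE V (\<lambda>_. F)" and nonsing: "nonsingular V J g p"
  shows "card V \<le> card J"
proof -
  have "card (PiE V (\<lambda>_. F)) \<le> card (PiE J (\<lambda>_. F))"
    using J by (intro card_inj_on_le[OF inj_jacobian_map[OF V g nonsing]
        jacobian_map_image_subset[OF g p]] finite_PiE) auto
  then show ?thesis using V J card_F_gt_1 by (simp add: card_PiE)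
qed

lemma card_minimal_nonsingular_le:
  assumes V: "finite V" and J: "finite J" and g: "\<And>j. j \<in> J \<Longrightarrow> poly_fun V d (g j)"
    and nonsing: "nonsingular V J g p"
    and minimal: "\<And>j. j \<in> J \<Longrightarrow> \<not> nonsingular V (J - {j}) g p"
  shows "card J \<le> card V"
proof -
  have "\<exists>v \<in> PiE V (\<lambda>_. F). (\<forall>i\<in>J - {j}. dir_deriv (g i) p v = 0) \<and> dir_deriv (g j) p v \<noteq> 0"
    if "j \<in> J" for j
    using minimal[OF that] nonsing unfolding nonsingular_def by (metis DiffI singletonD)
  then obtain v where v: "\<And>j. j \<in> J \<Longrightarrow> v j \<in> PiE V (\<lambda>_. F)"
    "\<And>i j. i \<in> J \<Longrightarrow> j \<in> J \<Longrightarrow> i \<noteq> j \<Longrightarrow> dir_deriv (g i) p (v j) = 0"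
    "\<And>j. j \<in> J \<Longrightarrow> dir_deriv (g j) p (v j) \<noteq> 0"
    by (metis DiffI singletonD)
  define comb where "comb t = (\<lambda>i\<in>V. \<Sum>j\<in>J. t j * v j i)" for t
  have deriv_comb: "dir_deriv (g k) p (comb t) = t k * dir_deriv (g k) p (v k)"
    if "k \<in> J" for k t
  proof -
    have "dir_deriv (g k) p (comb t) = dir_deriv (g k) p (\<lambda>i. \<Sum>j\<in>J. t j * v j i)"
      by (rule dir_deriv_cong[OF g[OF that]]) (auto simp: comb_def)
    also have "\<dots> = (\<Sum>j\<in>J. if j = k then t k * dir_deriv (g k) p (v k) else 0)"
      unfolding dir_deriv_linear_combination[OF V g[OF that]]
      using v(2) that by (intro sum.cong) auto
    finally show ?thesis using that J by simp
  qed
  have "inj_on comb (PiE J (\<lambda>_. F))"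
  proof (rule inj_onI)
    fix t u assume t: "t \<in> PiE J (\<lambda>_. F)" and u: "u \<in> PiE J (\<lambda>_. F)" and "comb t = comb u"
    then have "t k = u k" if "k \<in> J" for k
      using deriv_comb[OF that, of t] deriv_comb[OF that, of u] v(3)[OF that] by simp
    then show "t = u" by (rule PiE_ext[OF t u])
  qed
  moreover have "comb ` PiE J (\<lambda>_. F) \<subseteq> PiE V (\<lambda>_. F)"
    unfolding comb_def
    by (intro image_subsetI restrict_PiE_iff[THEN iffD2] ballI sum_in mult_in)
       (use PiE_mem[OF v(1)] in \<open>auto dest: PiE_mem\<close>)
  ultimately have "card (PiE J (\<lambda>_. F)) \<le> card (PiE V (\<lambda>_. F))"
    using V by (intro card_inj_on_le finite_PiE) auto
  then show ?thesis using V J card_F_gt_1 by (simp add: card_PiE)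
qed

lemma square_subsystem:
  assumes V: "finite V" and J: "finite J" and g: "\<And>j. j \<in> J \<Longrightarrow> poly_fun V d (g j)"
    and p: "p \<in> nonsingular_zeros V J g"
  obtains J' where "J' \<subseteq> J" "card J' = card V" "p \<in> nonsingular_zeros V J' g"
proof -
  have p_in: "p \<in> PiE V (\<lambda>_. F)" and "nonsingular V J g p"
    using p by (auto simp: nonsingular_zeros_def)
  then have "finite {K \<in> Pow J. nonsingular V K g p}" "{K \<in> Pow J. nonsingular V K g p} \<noteq> {}"
    using J by auto
  from finite_has_minimal[OF this] obtain J' where J': "J' \<subseteq> J" "nonsingular V J' g p"
    and "\<forall>K\<in>{K \<in> Pow J. nonsingular V K g p}. K \<subseteq> J' \<longrightarrow> J' = K" by blast
  then have minimal: "\<not> nonsingular V K g p" if "K \<subset> J'" for K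
    using that by auto
  have g': "poly_fun V d (g j)" if "j \<in> J'" for j using g J'(1) that by blast
  have fin: "finite J'" using J J'(1) by (rule rev_finite_subset)
  have "card V \<le> card J'" using card_le_card_nonsingular[OF V fin _ p_in J'(2)] g' by blast
  moreover have "card J' \<le> card V"
    by (rule card_minimal_nonsingular_le[OF V fin _ J'(2) minimal]) (use g' in auto)
  ultimately show ?thesis using that[OF J'(1)] J' p by (auto simp: nonsingular_zeros_def)
qed

lemma dependence_counting:
  fixes \<delta> :: nat
  assumes "n < k" "1 \<le> d" and \<delta>: "(k * d) ^ n \<le> \<delta>"
  shows "(k * \<delta> * d + 1) ^ n < (\<delta> + 1) ^ k"
proof -
  have "1 \<le> k * d" using assms(1,2) by simp
  then have "k * \<delta> * d + 1 \<le> (k * d) * (\<delta> + 1)" by (simp add: algebra_simps)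
  then have "(k * \<delta> * d + 1) ^ n \<le> ((k * d) * (\<delta> + 1)) ^ n" by (rule power_mono) simp
  also have "\<dots> \<le> \<delta> * (\<delta> + 1) ^ n"
    unfolding power_mult_distrib[of "k * d" "\<delta> + 1"] using \<delta> by (rule mult_right_mono) simp
  also have "\<dots> < (\<delta> + 1) ^ Suc n" by simp
  also have "\<dots> \<le> (\<delta> + 1) ^ k" using assms(1) by (intro power_increasing) auto
  finally show ?thesis .
qed

lemma algebraic_dependence:
  fixes g :: "'j \<Rightarrow> ('v \<Rightarrow> 'k) \<Rightarrow> 'k"
  assumes V: "finite V" and K: "finite K" "card V < card K" and d: "d \<ge> 1"
    and g: "\<And>k. k \<in> K \<Longrightarrow> poly_fun V d (g k)" and \<delta>: "(card K * d) ^ card V \<le> \<delta>"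
  obtains c where "\<exists>a\<in>exponents K \<delta>. c a \<noteq> 0"
    "\<And>x. (\<Sum>a\<in>exponents K \<delta>. c a * monomial K a (\<lambda>k. g k x)) = 0"
proof -
  define e where "e = card K * \<delta> * d"
  define \<Phi> where "\<Phi> c x = (\<Sum>a\<in>exponents K \<delta>. c a * monomial K a (\<lambda>k. g k x))"
    for c :: "('j \<Rightarrow> nat) \<Rightarrow> 'k" and x
  let ?C = "PiE (exponents K \<delta>) (\<lambda>_. F)"
  have fin: "finite (exponents K \<delta>)" using K by (intro finite_PiE) auto
  have "\<Phi> c \<in> poly_funs V e" if c: "c \<in> ?C" for c
    unfolding \<Phi>_def mem_Collect_eq
  proof (intro poly_fun_sum poly_fun_scale PiE_mem[OF c])
    fix a assume a: "a \<in> exponents K \<delta>"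
    then have "sum a K \<le> (\<Sum>k\<in>K. \<delta>)" by (intro sum_mono) (auto dest: PiE_mem)
    then have "sum a K * d \<le> e" by (simp add: e_def)
    with poly_fun_monomial[OF g] show "poly_fun V e (\<lambda>x. monomial K a (\<lambda>k. g k x))"
      by (rule poly_fun_mono)
  qed
  moreover have "card (poly_funs V e) < card ?C"
  proof -
    have "(e + 1) ^ card V < card (exponents K \<delta>)"
      using dependence_counting[OF K(2) d \<delta>] K(1) by (simp add: e_def card_exponents)
    then have "card F ^ ((e + 1) ^ card V) < card F ^ card (exponents K \<delta>)"
      using card_F_gt_1 by (intro power_strict_increasing) auto
    then show ?thesis using card_poly_funs_le[OF V, of e] fin by (simp add: card_PiE)
  qed
  ultimately have "\<not> inj_on \<Phi> ?C"
    using finite_poly_funs[OF V] by (metis card_inj_on_le image_subsetI not_le)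
  then obtain b c where bc: "b \<in> ?C" "c \<in> ?C" "b \<noteq> c" "\<Phi> b = \<Phi> c" by (auto simp: inj_on_def)
  show ?thesis
  proof
    show "\<exists>a\<in>exponents K \<delta>. b a - c a \<noteq> 0"
      using bc(3) PiE_ext[OF bc(1,2)] by auto
    show "(\<Sum>a\<in>exponents K \<delta>. (b a - c a) * monomial K a (\<lambda>k. g k x)) = 0" for x
      using fun_cong[OF bc(4), of x] by (simp add: \<Phi>_def left_diff_distrib sum_subtractf)
  qed
qed

lemma lowest_form_vanishes:
  assumes K: "finite K" "J \<subseteq> K" and g: "\<And>k. k \<in> K \<Longrightarrow> poly_fun V d (g k)"
    and rel: "\<And>x. (\<Sum>a\<in>A. c a * monomial K a (\<lambda>k. g k x)) = 0"
    and zero: "\<And>j. j \<in> J \<Longrightarrow> g j p = 0"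
    and m: "\<And>a. a \<in> A \<Longrightarrow> c a \<noteq> 0 \<Longrightarrow> m \<le> sum a J"
  shows "(\<Sum>a\<in>A. (if sum a J = m then c a else 0) *
    monomial K a (\<lambda>k. if k \<in> J then dir_deriv (g k) p v else g k p)) = 0"
proof -
  have "\<exists>\<pi>. (\<forall>\<tau>. g k (\<lambda>i. p i + \<tau> * v i) = poly \<pi> \<tau>) \<and>
      coeff \<pi> 0 = g k p \<and> coeff \<pi> 1 = dir_deriv (g k) p v" if "k \<in> K" for k
    using poly_fun_line[OF g[OF that]] by blast
  then obtain \<pi> where \<pi>: "\<And>k \<tau>. k \<in> K \<Longrightarrow> g k (\<lambda>i. p i + \<tau> * v i) = poly (\<pi> k) \<tau>"
    "\<And>k. k \<in> K \<Longrightarrow> coeff (\<pi> k) 0 = g k p" "\<And>k. k \<in> K \<Longrightarrow> coeff (\<pi> k) 1 = dir_deriv (g k) p v"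
    by metis
  define \<Psi> where "\<Psi> = (\<Sum>a\<in>A. smult (c a) (monomial K a \<pi>))"
  have "\<Psi> = 0"
  proof (rule poly_ext)
    fix \<tau>
    have "poly (monomial K a \<pi>) \<tau> = monomial K a (\<lambda>k. g k (\<lambda>i. p i + \<tau> * v i))" for a
      by (simp add: monomial_def poly_prod \<pi>(1))
    then show "poly \<Psi> \<tau> = poly 0 \<tau>" using rel by (simp add: \<Psi>_def poly_sum)
  qed
  have "c a * coeff (monomial K a \<pi>) m = (if sum a J = m then c a else 0) *
      monomial K a (\<lambda>k. if k \<in> J then dir_deriv (g k) p v else g k p)" if "a \<in> A" for a
  proof (cases "c a = 0")
    case False
    have "monomial K a (\<lambda>k. coeff (\<pi> k) (if k \<in> J then 1 else 0)) =
        monomial K a (\<lambda>k. if k \<in> J then dir_deriv (g k) p v else g k p)"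
      using \<pi>(2,3) by (intro monomial_cong) auto
    moreover have "coeff (\<pi> j) 0 = 0" if "j \<in> J" for j
      using zero \<pi>(2) K(2) that by auto
    ultimately show ?thesis
      using coeff_monomial_lowest[OF K _ m[OF that False], of \<pi>] by simp
  qed simp
  then have "(\<Sum>a\<in>A. (if sum a J = m then c a else 0) *
      monomial K a (\<lambda>k. if k \<in> J then dir_deriv (g k) p v else g k p)) = coeff \<Psi> m"
    by (simp add: \<Psi>_def coeff_sum)
  then show ?thesis by (simp add: \<open>\<Psi> = 0\<close>)
qed

lemma nonsingular_zero_derivatives:
  assumes V: "finite V" and J: "finite J" "card J = card V"
    and g: "\<And>j. j \<in> J \<Longrightarrow> poly_fun V d (g j)"
    and p: "p \<in> nonsingular_zeros V J g" and y: "\<And>j. j \<in> J \<Longrightarrow> y j \<in> F"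
  obtains v where "\<And>j. j \<in> J \<Longrightarrow> dir_deriv (g j) p v = y j"
proof -
  have "restrict y J \<in> jacobian_map J g p ` PiE V (\<lambda>_. F)"
    using p y by (subst jacobian_map_surj[OF V J g]) (auto simp: nonsingular_zeros_def)
  then obtain v where "restrict y J = jacobian_map J g p v" by blast
  then have "dir_deriv (g j) p v = y j" if "j \<in> J" for j
    using that by (metis restrict_apply')
  then show ?thesis by (rule that)
qed

text \<open>
  The coordinate \<open>x\<^sub>i\<close> and the polynomials \<open>g\<^sub>j\<close> are algebraically dependent. The part of a relation
  that has lowest degree in the \<open>g\<^sub>j\<close> vanishes at \<open>x\<^sub>i = p\<^sub>i\<close> and arbitrary values of the \<open>g\<^sub>j\<close> for
  every nonsingular zero \<open>p\<close>, as the Jacobian map is onto there.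
\<close>

lemma card_coordinate_nonsingular_zeros:
  fixes g :: "'j \<Rightarrow> ('v \<Rightarrow> 'k) \<Rightarrow> 'k"
  assumes V: "finite V" and J: "finite J" "card J = card V" and d: "d \<ge> 1"
    and g: "\<And>j. j \<in> J \<Longrightarrow> poly_fun V d (g j)"
    and \<delta>: "((card V + 1) * d) ^ card V \<le> \<delta>" "\<delta> < card F" and i: "i \<in> V"
  shows "card ((\<lambda>p. p i) ` nonsingular_zeros V J g) \<le> \<delta>"
proof (rule ccontr)
  define Y where "Y = (\<lambda>p. p i) ` nonsingular_zeros V J g"
  assume "\<not> card ((\<lambda>p. p i) ` nonsingular_zeros V J g) \<le> \<delta>"
  then have Y: "card Y > \<delta>" by (simp add: Y_def)
  define K where "K = insert None (Some ` J)"
  define G where "G k = (case k of None \<Rightarrow> \<lambda>x. x i | Some j \<Rightarrow> g j)" for k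
  have K: "finite K" "Some ` J \<subseteq> K" "card K = card V + 1"
    using J by (auto simp: K_def card_image)
  have G: "poly_fun V d (G k)" if "k \<in> K" for k
    using that g poly_fun.var[OF i d] by (auto simp: G_def K_def)
  obtain c where nontrivial: "\<exists>a\<in>exponents K \<delta>. c a \<noteq> 0"
    and rel: "\<And>x. (\<Sum>a\<in>exponents K \<delta>. c a * monomial K a (\<lambda>k. G k x)) = 0"
    using algebraic_dependence[OF V K(1) _ d, of G \<delta>] G \<delta>(1) K(3) by auto
  define support where "support = {a \<in> exponents K \<delta>. c a \<noteq> 0}"
  obtain a where "a \<in> support" using nontrivial by (auto simp: support_def)
  from ex_has_least_nat[of "\<lambda>a. a \<in> support", OF this, of "\<lambda>a. sum a (Some ` J)"]
  obtain a0 where "a0 \<in> support" "\<forall>a. a \<in> support \<longrightarrow> sum a0 (Some ` J) \<le> sum a (Some ` J)"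
    by (elim exE conjE)
  then have a0: "a0 \<in> exponents K \<delta>" "c a0 \<noteq> 0"
    and min: "\<And>a. a \<in> exponents K \<delta> \<Longrightarrow> c a \<noteq> 0 \<Longrightarrow> sum a0 (Some ` J) \<le> sum a (Some ` J)"
    by (simp_all add: support_def)
  define low where "low a = (if sum a (Some ` J) = sum a0 (Some ` J) then c a else 0)" for a
  have "low a0 = 0"
  proof (rule vanishing_on_grid_imp_coeff_zero[OF K(1) _ _ a0(1)])
    show "card (case_option Y (\<lambda>_. F) k) > \<delta>" for k
      using Y \<delta>(2) by (simp split: option.split)
    fix z assume z: "z \<in> PiE K (case_option Y (\<lambda>_. F))"
    then obtain p where p: "p \<in> nonsingular_zeros V J g" "z None = p i"
      by (auto simp: K_def Y_def dest!: PiE_mem[of _ _ _ None])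
    have "z (Some j) \<in> F" if "j \<in> J" for j
      using PiE_mem[OF z, of "Some j"] that by (simp add: K_def)
    then obtain v where "\<And>j. j \<in> J \<Longrightarrow> dir_deriv (g j) p v = z (Some j)"
      using nonsingular_zero_derivatives[OF V J g p(1), of "\<lambda>j. z (Some j)"] by blast
    then have "monomial K a z =
        monomial K a (\<lambda>k. if k \<in> Some ` J then dir_deriv (G k) p v else G k p)" for a
      using p(2) by (intro monomial_cong) (auto simp: K_def G_def)
    moreover have "G k p = 0" if "k \<in> Some ` J" for k
      using that p(1) by (auto simp: G_def nonsingular_zeros_def)
    ultimately show "(\<Sum>a\<in>exponents K \<delta>. low a * monomial K a z) = 0"
      unfolding low_def using lowest_form_vanishes[OF K(1,2) G rel _ min] by simp
  qed
  then show False using a0(2) by (simp add: low_def)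
qed

lemma card_le_card_coordinates_power:
  assumes V: "finite V" and S: "S \<subseteq> PiE V (\<lambda>_. A)" "finite S"
    and n: "\<And>i. i \<in> V \<Longrightarrow> card ((\<lambda>p. p i) ` S) \<le> n"
  shows "card S \<le> n ^ card V"
proof -
  have "S \<subseteq> PiE V (\<lambda>i. (\<lambda>p. p i) ` S)" using S by (auto simp: PiE_def)
  then have "card S \<le> card (PiE V (\<lambda>i. (\<lambda>p. p i) ` S))"
    using V S by (intro card_mono finite_PiE) auto
  also have "\<dots> \<le> (\<Prod>i\<in>V. n)" unfolding card_PiE[OF V] using n by (intro prod_mono) auto
  finally show ?thesis by simp
qed

lemma card_nonsingular_zeros:
  fixes g :: "'j \<Rightarrow> ('v \<Rightarrow> 'k) \<Rightarrow> 'k"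
  assumes V: "finite V" and J: "finite J" and d: "d \<ge> 1"
    and g: "\<And>j. j \<in> J \<Longrightarrow> poly_fun V d (g j)"
    and \<delta>: "((card V + 1) * d) ^ card V \<le> \<delta>" "\<delta> < card F"
  shows "card (nonsingular_zeros V J g) \<le> 2 ^ card J * \<delta> ^ card V"
proof -
  define squares where "squares = {J' \<in> Pow J. card J' = card V}"
  have fin: "finite squares" "card squares \<le> 2 ^ card J"
    using J card_mono[of "Pow J" squares] by (auto simp: squares_def card_Pow)
  have square: "card (nonsingular_zeros V J' g) \<le> \<delta> ^ card V" if "J' \<in> squares" for J'
  proof (rule card_le_card_coordinates_power[OF V _ finite_nonsingular_zeros[OF V]])
    have "J' \<subseteq> J" "card J' = card V" using that by (auto simp: squares_def)
    moreover from this have "finite J'" using J finite_subset by blast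
    ultimately show "card ((\<lambda>p. p i) ` nonsingular_zeros V J' g) \<le> \<delta>" if "i \<in> V" for i
      using that by (intro card_coordinate_nonsingular_zeros[OF V _ _ d g \<delta>]) auto
  qed (auto simp: nonsingular_zeros_def)
  have "nonsingular_zeros V J g \<subseteq> (\<Union>J'\<in>squares. nonsingular_zeros V J' g)"
  proof
    fix p assume "p \<in> nonsingular_zeros V J g"
    from square_subsystem[OF V J g this]
    obtain J' where "J' \<subseteq> J" "card J' = card V" "p \<in> nonsingular_zeros V J' g" by blast
    then show "p \<in> (\<Union>J'\<in>squares. nonsingular_zeros V J' g)" by (auto simp: squares_def)
  qed
  then have "card (nonsingular_zeros V J g) \<le> card (\<Union>J'\<in>squares. nonsingular_zeros V J' g)"
    using fin V by (intro card_mono finite_UN_I finite_nonsingular_zeros) auto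
  also have "\<dots> \<le> (\<Sum>J'\<in>squares. card (nonsingular_zeros V J' g))" by (rule card_UN_le[OF fin(1)])
  also have "\<dots> \<le> card squares * \<delta> ^ card V" using sum_bounded_above[OF square] by simp
  also have "\<dots> \<le> 2 ^ card J * \<delta> ^ card V" using fin(2) by simp
  finally show ?thesis .
qed

section \<open>Values and derivatives of random polynomial functions\<close>

lemma exists_flat_bump:
  fixes W :: "'w set" and P :: "'a \<Rightarrow> 'w \<Rightarrow> 'k"
  assumes W: "finite W" and A: "finite A"
    and P: "\<And>a w. a \<in> A \<Longrightarrow> w \<in> W \<Longrightarrow> P a w \<in> F" and p: "\<And>w. w \<in> W \<Longrightarrow> p w \<in> F"
    and distinct: "\<And>a. a \<in> A \<Longrightarrow> \<exists>w\<in>W. P a w \<noteq> p w"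
  shows "\<exists>g. poly_fun W (2 * card A) g \<and> g p = 1 \<and>
    (\<forall>a\<in>A. g (P a) = 0 \<and> (\<forall>v. dir_deriv g (P a) v = 0))"
  using A P distinct
proof (induction A rule: finite_induct)
  case empty
  show ?case by (rule exI[of _ "\<lambda>x. 1"]) (simp add: poly_fun.const)
next
  case (insert a A)
  then obtain g where g: "poly_fun W (2 * card A) g" "g p = 1"
    "\<And>b. b \<in> A \<Longrightarrow> g (P b) = 0" "\<And>b v. b \<in> A \<Longrightarrow> dir_deriv g (P b) v = 0" by auto
  obtain w where w: "w \<in> W" "P a w \<noteq> p w" using insert.prems(2) by blast
  define \<mu> where "\<mu> x = 1 / (p w - P a w) * (x w - P a w)" for x
  have \<mu>: "poly_fun W 1 \<mu>"
    unfolding \<mu>_def using w p insert.prems(1)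
    by (intro poly_fun_scale poly_fun_diff poly_fun.var poly_fun.const) auto
  have square: "poly_fun W 2 (\<lambda>x. \<mu> x * \<mu> x)" by (rule poly_fun.mult[OF \<mu> \<mu>]) simp
  have \<mu>_a: "\<mu> (P a) = 0" and \<mu>_p: "\<mu> p = 1" using w(2) by (auto simp: \<mu>_def)
  show ?case
  proof (intro exI conjI ballI allI)
    show "poly_fun W (2 * card (insert a A)) (\<lambda>x. g x * (\<mu> x * \<mu> x))"
      using insert.hyps by (intro poly_fun.mult[OF g(1) square]) simp
    show "g p * (\<mu> p * \<mu> p) = 1" using g(2) \<mu>_p by simp
    fix b assume "b \<in> insert a A"
    then show "g (P b) * (\<mu> (P b) * \<mu> (P b)) = 0"
      and "dir_deriv (\<lambda>x. g x * (\<mu> x * \<mu> x)) (P b) v = 0" for v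
      using g(3,4) \<mu>_a by (auto simp: dir_deriv_mult[OF g(1) square] dir_deriv_mult[OF \<mu> \<mu>])
  qed
qed

lemma exists_affine_interpolant:
  assumes p: "\<And>w. w \<in> W \<Longrightarrow> p w \<in> F" and v: "\<And>w. w \<in> W \<Longrightarrow> v w \<in> F" and "t \<in> F" "u \<in> F"
  shows "\<exists>g. poly_fun W 1 g \<and> g p = t \<and> ((\<exists>w\<in>W. v w \<noteq> 0) \<longrightarrow> dir_deriv g p v = u)"
proof (cases "\<exists>w\<in>W. v w \<noteq> 0")
  case True
  then obtain w where w: "w \<in> W" "v w \<noteq> 0" by blast
  have "poly_fun W 1 (\<lambda>x. (t - u / v w * p w) + u / v w * x w)"
    using assms w by (intro poly_fun.add poly_fun.const poly_fun_scale poly_fun.var) auto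
  moreover have "dir_deriv (\<lambda>x. (t - u / v w * p w) + u / v w * x w) p v = u"
    using w by (subst dir_deriv_eq_coeff[of _ _ _ "[:t, u:]"]) (auto simp: field_simps)
  ultimately show ?thesis by (intro exI[of _ "\<lambda>x. (t - u / v w * p w) + u / v w * x w"]) auto
next
  case False
  then show ?thesis using poly_fun.const[OF assms(3)] by blast
qed

lemma exists_hermite_bump:
  fixes W :: "'w set" and P :: "'a \<Rightarrow> 'w \<Rightarrow> 'k"
  assumes W: "finite W" and A: "finite A"
    and P: "\<And>a w. a \<in> A \<Longrightarrow> w \<in> W \<Longrightarrow> P a w \<in> F" and p: "\<And>w. w \<in> W \<Longrightarrow> p w \<in> F"
    and distinct: "\<And>a. a \<in> A \<Longrightarrow> \<exists>w\<in>W. P a w \<noteq> p w"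
    and v: "\<And>w. w \<in> W \<Longrightarrow> v w \<in> F" and "t \<in> F" "u \<in> F"
  shows "\<exists>g. poly_fun W (2 * card A + 1) g \<and> g p = t \<and>
    ((\<exists>w\<in>W. v w \<noteq> 0) \<longrightarrow> dir_deriv g p v = u) \<and>
    (\<forall>a\<in>A. g (P a) = 0 \<and> (\<forall>v. dir_deriv g (P a) v = 0))"
proof -
  obtain h where h: "poly_fun W (2 * card A) h" "h p = 1"
    "\<And>a. a \<in> A \<Longrightarrow> h (P a) = 0" "\<And>a v. a \<in> A \<Longrightarrow> dir_deriv h (P a) v = 0"
    using exists_flat_bump[OF W A, of P p] P p distinct by auto
  have "u - t * dir_deriv h p v \<in> F"
    using assms(7,8) dir_deriv_in[OF h(1) p v] by simp
  then obtain m where m: "poly_fun W 1 m" "m p = t"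
    "\<exists>w\<in>W. v w \<noteq> 0 \<Longrightarrow> dir_deriv m p v = u - t * dir_deriv h p v"
    using exists_affine_interpolant[of W p v t, OF p v assms(7)] by blast
  note deriv_mult = dir_deriv_mult[OF h(1) m(1)]
  show ?thesis
  proof (intro exI conjI impI ballI allI)
    show "poly_fun W (2 * card A + 1) (\<lambda>x. h x * m x)" by (rule poly_fun.mult[OF h(1) m(1)]) simp
    show "h p * m p = t" using h(2) m(2) by simp
    show "dir_deriv (\<lambda>x. h x * m x) p v = u" if "\<exists>w\<in>W. v w \<noteq> 0"
      using m(2) m(3)[OF that] h(2) by (simp add: deriv_mult)
    show "h (P a) * m (P a) = 0" if "a \<in> A" for a using h(3)[OF that] by simp
    show "dir_deriv (\<lambda>x. h x * m x) (P a) v' = 0" if "a \<in> A" for a v'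
      using h(3,4)[OF that] by (simp add: deriv_mult)
  qed
qed

lemma exists_interpolant:
  fixes W :: "'w set" and A :: "'a set" and P v :: "'a \<Rightarrow> 'w \<Rightarrow> 'k"
  assumes W: "finite W" and A: "finite A"
    and P: "\<And>a w. a \<in> A \<Longrightarrow> w \<in> W \<Longrightarrow> P a w \<in> F"
    and distinct: "inj_on (\<lambda>a. restrict (P a) W) A"
    and v: "\<And>a w. a \<in> A \<Longrightarrow> w \<in> W \<Longrightarrow> v a w \<in> F"
    and z: "\<And>a. a \<in> A \<Longrightarrow> z a \<in> F" and u: "\<And>a. a \<in> A \<Longrightarrow> u a \<in> F"
  shows "\<exists>g. poly_fun W (2 * card A) g \<and> (\<forall>a\<in>A. g (P a) = z a) \<and>
    (\<forall>a\<in>A. (\<exists>w\<in>W. v a w \<noteq> 0) \<longrightarrow> dir_deriv g (P a) (v a) = u a)"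
  using A P distinct v z u
proof (induction A rule: finite_induct)
  case empty
  show ?case by (rule exI[of _ "\<lambda>x. 0"]) (simp add: poly_fun.const)
next
  case (insert a A)
  have "inj_on (\<lambda>a. restrict (P a) W) A"
    using insert.prems(2) by (rule inj_on_subset) auto
  then obtain g where g: "poly_fun W (2 * card A) g" "\<And>b. b \<in> A \<Longrightarrow> g (P b) = z b"
    "\<And>b. b \<in> A \<Longrightarrow> \<exists>w\<in>W. v b w \<noteq> 0 \<Longrightarrow> dir_deriv g (P b) (v b) = u b"
    using insert by auto
  have separated: "\<exists>w\<in>W. P b w \<noteq> P a w" if "b \<in> A" for b
    using insert.prems(2) insert.hyps that
    by (metis (mono_tags, lifting) inj_onD insertCI restrict_ext)
  have "z a - g (P a) \<in> F" "u a - dir_deriv g (P a) (v a) \<in> F"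
    using insert.prems poly_fun_in[OF g(1)] dir_deriv_in[OF g(1)] by auto
  then obtain h where h: "poly_fun W (2 * card A + 1) h" "h (P a) = z a - g (P a)"
    "\<exists>w\<in>W. v a w \<noteq> 0 \<Longrightarrow> dir_deriv h (P a) (v a) = u a - dir_deriv g (P a) (v a)"
    "\<And>b. b \<in> A \<Longrightarrow> h (P b) = 0" "\<And>b w. b \<in> A \<Longrightarrow> dir_deriv h (P b) w = 0"
    using exists_hermite_bump[OF W insert.hyps(1), of P "P a" "v a" "z a - g (P a)"
        "u a - dir_deriv g (P a) (v a)"] insert.prems(1,3) separated by auto
  show ?case
  proof (intro exI conjI ballI impI)
    have "2 * card A + 1 \<le> 2 * card (insert a A)" using insert.hyps by simp
    then show "poly_fun W (2 * card (insert a A)) (\<lambda>x. g x + h x)"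
      using g(1) h(1) by (intro poly_fun.add) (auto elim: poly_fun_mono)
    show "g (P b) + h (P b) = z b" if "b \<in> insert a A" for b
      using that g(2) h(2,4) by auto
    show "dir_deriv (\<lambda>x. g x + h x) (P b) (v b) = u b"
      if b: "b \<in> insert a A" "\<exists>w\<in>W. v b w \<noteq> 0" for b
    proof (cases "b = a")
      case True
      then show ?thesis using h(3) b(2) by (simp add: dir_deriv_add[OF g(1) h(1)])
    next
      case False
      then show ?thesis
        using g(3)[OF _ b(2)] h(5) b(1) by (simp add: dir_deriv_add[OF g(1) h(1)])
    qed
  qed
qed

end

lemma card_fibre_mult_card:
  assumes G: "finite G" and T: "finite T" "ev ` G \<subseteq> T" and t0: "t0 \<in> T"
    and translate: "\<And>t t'. t \<in> T \<Longrightarrow> t' \<in> T \<Longrightarrow>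
      \<exists>\<phi>. inj_on \<phi> {g \<in> G. ev g = t} \<and> \<phi> ` {g \<in> G. ev g = t} \<subseteq> {g \<in> G. ev g = t'}"
  shows "card {g \<in> G. ev g = t0} * card T = card G"
proof -
  have fibre_le: "card {g \<in> G. ev g = t} \<le> card {g \<in> G. ev g = t'}" if "t \<in> T" "t' \<in> T" for t t'
    using translate[OF that] G by (auto intro: card_inj_on_le)
  have "card G = (\<Sum>t\<in>T. card {g \<in> G. ev g = t})"
    using sum.group[OF G T, of "\<lambda>_. 1 :: nat"] by simp
  also have "\<dots> = (\<Sum>t\<in>T. card {g \<in> G. ev g = t0})"
    using fibre_le[OF t0] fibre_le[OF _ t0] by (intro sum.cong refl antisym) auto
  finally show ?thesis by simp
qed

context finite_subfield
begin

definition eval_all :: "'r set \<Rightarrow> ('r \<Rightarrow> ('w \<Rightarrow> 'k) \<Rightarrow> 'k) \<Rightarrow> ('w \<Rightarrow> 'k) \<Rightarrow> 'r \<Rightarrow> 'k" where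
  "eval_all Q f x = (\<lambda>\<rho>\<in>Q. f \<rho> x)"

context
  fixes W :: "'w set" and A B :: "'a set" and P v :: "'a \<Rightarrow> 'w \<Rightarrow> 'k" and d :: nat
  assumes W: "finite W" and A: "finite A" "2 * card A \<le> d" and B: "B \<subseteq> A"
    and P: "\<And>a w. a \<in> A \<Longrightarrow> w \<in> W \<Longrightarrow> P a w \<in> F" and distinct: "inj_on (\<lambda>a. restrict (P a) W) A"
    and v: "\<And>a w. a \<in> B \<Longrightarrow> w \<in> W \<Longrightarrow> v a w \<in> F" "\<And>a. a \<in> B \<Longrightarrow> \<exists>w\<in>W. v a w \<noteq> 0"
begin

lemma exists_hermite_interpolant:
  assumes "\<And>a. a \<in> A \<Longrightarrow> z a \<in> F" and "\<And>a. a \<in> B \<Longrightarrow> u a \<in> F"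
  obtains g where "poly_fun W d g" "\<And>a. a \<in> A \<Longrightarrow> g (P a) = z a"
    "\<And>a. a \<in> B \<Longrightarrow> dir_deriv g (P a) (v a) = u a"
proof -
  have "\<exists>g. poly_fun W (2 * card A) g \<and> (\<forall>a\<in>A. g (P a) = z a) \<and>
      (\<forall>a\<in>A. (\<exists>w\<in>W. (if a \<in> B then v a w else 0) \<noteq> 0) \<longrightarrow>
        dir_deriv g (P a) (\<lambda>w. if a \<in> B then v a w else 0) = (if a \<in> B then u a else 0))"
    using assms v(1) by (intro exists_interpolant[OF W A(1) P distinct]) auto
  then obtain g where g: "poly_fun W (2 * card A) g" "\<And>a. a \<in> A \<Longrightarrow> g (P a) = z a"
    "\<And>a. a \<in> B \<Longrightarrow> dir_deriv g (P a) (v a) = u a"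
    using v(2) B by (fastforce split: if_splits)
  show ?thesis by (rule that[OF poly_fun_mono[OF g(1) A(2)] g(2,3)])
qed

text \<open>Values and directional derivatives of a random polynomial function are thus independent.\<close>

lemma card_interpolants:
  assumes z: "\<And>a. a \<in> A \<Longrightarrow> z a \<in> F" and u: "\<And>a. a \<in> B \<Longrightarrow> u a \<in> F"
  shows "card {g \<in> poly_funs W d. (\<forall>a\<in>A. g (P a) = z a) \<and> (\<forall>a\<in>B. dir_deriv g (P a) (v a) = u a)}
    * card F ^ (card A + card B) = card (poly_funs W d)"
proof -
  let ?T = "PiE A (\<lambda>_. F) \<times> PiE B (\<lambda>_. F)"
  define ev where "ev g = (\<lambda>a\<in>A. g (P a), \<lambda>a\<in>B. dir_deriv g (P a) (v a))" for g
  have fin: "finite (poly_funs W d)" "finite B" using W A B finite_poly_funs finite_subset by auto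
  have "card {g \<in> poly_funs W d. ev g = (restrict z A, restrict u B)} * card ?T =
      card (poly_funs W d)"
  proof (rule card_fibre_mult_card[OF fin(1)])
    show "finite ?T" using A fin(2) by (simp add: finite_PiE)
    show "(restrict z A, restrict u B) \<in> ?T" using z u by auto
    show "ev ` poly_funs W d \<subseteq> ?T"
      using poly_fun_in[of W d] dir_deriv_in[of W d] P v(1) B by (auto simp: ev_def)
    fix t t' assume t: "t \<in> ?T" and t': "t' \<in> ?T"
    have "fst t' a - fst t a \<in> F" if "a \<in> A" for a
      using t t' that by (auto dest!: PiE_mem)
    moreover have "snd t' a - snd t a \<in> F" if "a \<in> B" for a
      using t t' that by (auto dest!: PiE_mem)
    ultimately obtain h where h: "poly_fun W d h"
      "\<And>a. a \<in> A \<Longrightarrow> h (P a) = fst t' a - fst t a"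
      "\<And>a. a \<in> B \<Longrightarrow> dir_deriv h (P a) (v a) = snd t' a - snd t a"
      by (rule exists_hermite_interpolant) blast+
    have "ev (\<lambda>x. g x + h x) = t'" if g: "poly_fun W d g" "ev g = t" for g
    proof -
      have "ev (\<lambda>x. g x + h x) = (restrict (fst t') A, restrict (snd t') B)"
        using h(2,3) unfolding g(2)[symmetric]
        by (simp add: ev_def dir_deriv_add[OF g(1) h(1)] cong: restrict_cong)
      then show ?thesis using t' by (auto simp: PiE_restrict)
    qed
    moreover have "poly_fun W d (\<lambda>x. g x + h x)" if "poly_fun W d g" for g
      by (rule poly_fun.add[OF that h(1)])
    moreover have "inj_on (\<lambda>g x. g x + h x) G" for G by (rule inj_onI) (simp add: fun_eq_iff)
    ultimately show "\<exists>\<phi>. inj_on \<phi> {g \<in> poly_funs W d. ev g = t} \<and>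
        \<phi> ` {g \<in> poly_funs W d. ev g = t} \<subseteq> {g \<in> poly_funs W d. ev g = t'}"
      by (intro exI[of _ "\<lambda>g x. g x + h x"]) auto
  qed
  moreover have "ev g = (restrict z A, restrict u B) \<longleftrightarrow>
      (\<forall>a\<in>A. g (P a) = z a) \<and> (\<forall>a\<in>B. dir_deriv g (P a) (v a) = u a)" for g
    by (auto simp: ev_def fun_eq_iff restrict_def split: if_splits)
  ultimately show ?thesis
    using A fin(2) by (simp add: card_cartesian_product card_PiE power_add)
qed

lemma card_tuple_interpolants:
  fixes Q :: "'r set" and z :: "'a \<Rightarrow> 'r \<Rightarrow> 'k"
  assumes Q: "finite Q" and z: "\<And>a \<rho>. a \<in> A \<Longrightarrow> \<rho> \<in> Q \<Longrightarrow> z a \<rho> \<in> F"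
  shows "card {f \<in> PiE Q (\<lambda>_. poly_funs W d). (\<forall>a\<in>A. \<forall>\<rho>\<in>Q. f \<rho> (P a) = z a \<rho>) \<and>
      (\<forall>a\<in>B. \<forall>\<rho>\<in>Q. dir_deriv (f \<rho>) (P a) (v a) = 0)}
    * card F ^ (card Q * (card A + card B)) = card (poly_funs W d) ^ card Q"
    (is "card ?S * _ = _")
proof -
  define C where "C \<rho> = {g \<in> poly_funs W d. (\<forall>a\<in>A. g (P a) = z a \<rho>) \<and>
      (\<forall>a\<in>B. dir_deriv g (P a) (v a) = 0)}" for \<rho>
  have "?S = PiE Q C" by (auto simp: C_def PiE_iff extensional_def)
  then have "card ?S * card F ^ (card Q * (card A + card B)) =
      (\<Prod>\<rho>\<in>Q. card (C \<rho>) * card F ^ (card A + card B))"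
    by (simp add: card_PiE[OF Q] prod.distrib power_mult[symmetric] mult.commute)
  also have "\<dots> = (\<Prod>\<rho>\<in>Q. card (poly_funs W d))"
    unfolding C_def using z by (intro prod.cong refl card_interpolants) auto
  finally show ?thesis by simp
qed

lemma card_poly_tuples_hitting:
  fixes Q :: "'r set"
  assumes Q: "finite Q" and Z: "Z \<subseteq> PiE Q (\<lambda>_. F)"
  shows "card {f \<in> PiE Q (\<lambda>_. poly_funs W d). (\<forall>a\<in>A. eval_all Q f (P a) \<in> Z) \<and>
      (\<forall>a\<in>B. \<forall>\<rho>\<in>Q. dir_deriv (f \<rho>) (P a) (v a) = 0)}
    * card F ^ (card Q * (card A + card B)) = card Z ^ card A * card (poly_funs W d) ^ card Q"
    (is "card ?S * ?q = _")
proof -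
  define vals where "vals f = (\<lambda>a\<in>A. eval_all Q f (P a))" for f
  have fin_Z: "finite Z" using Q by (intro finite_subset[OF Z finite_PiE]) auto
  have fin_S: "finite ?S"
    using W by (intro finite_subset[OF _ finite_PiE[OF Q finite_poly_funs]]) auto
  have card_fibre: "card {f \<in> ?S. vals f = z} * ?q = card (poly_funs W d) ^ card Q"
    if z: "z \<in> PiE A (\<lambda>_. Z)" for z
  proof -
    have zQ: "z a \<in> PiE Q (\<lambda>_. F)" if "a \<in> A" for a using PiE_mem[OF z that] Z by blast
    have "vals f = z \<longleftrightarrow> (\<forall>a\<in>A. eval_all Q f (P a) = z a)" for f
      using z by (auto simp: vals_def fun_eq_iff PiE_def extensional_def)
    moreover have "eval_all Q f (P a) = z a \<longleftrightarrow> (\<forall>\<rho>\<in>Q. f \<rho> (P a) = z a \<rho>)" if "a \<in> A" for f a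
      using zQ[OF that] by (auto simp: eval_all_def fun_eq_iff PiE_def extensional_def)
    moreover have "eval_all Q f (P a) \<in> Z" if "vals f = z" "a \<in> A" for f a
      using PiE_mem[OF z that(2)] that by (auto simp: vals_def)
    ultimately have "{f \<in> ?S. vals f = z} =
        {f \<in> PiE Q (\<lambda>_. poly_funs W d). (\<forall>a\<in>A. \<forall>\<rho>\<in>Q. f \<rho> (P a) = z a \<rho>) \<and>
          (\<forall>a\<in>B. \<forall>\<rho>\<in>Q. dir_deriv (f \<rho>) (P a) (v a) = 0)}"
      by auto
    then show ?thesis using card_tuple_interpolants[OF Q, of z] PiE_mem[OF zQ] by simp
  qed
  have "card ?S = (\<Sum>z\<in>PiE A (\<lambda>_. Z). card {f \<in> ?S. vals f = z})"
    using sum.group[OF fin_S, of "PiE A (\<lambda>_. Z)" vals "\<lambda>_. 1 :: nat"] A(1) fin_Z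
    by (simp add: vals_def image_subset_iff finite_PiE)
  then have "card ?S * ?q = (\<Sum>z\<in>PiE A (\<lambda>_. Z). card {f \<in> ?S. vals f = z} * ?q)"
    by (simp add: sum_distrib_right)
  also have "\<dots> = (\<Sum>z\<in>PiE A (\<lambda>_. Z). card (poly_funs W d) ^ card Q)"
    by (intro sum.cong refl card_fibre)
  also have "\<dots> = card Z ^ card A * card (poly_funs W d) ^ card Q" using A(1) by (simp add: card_PiE)
  finally show ?thesis .
qed

end

end

lemma exists_large_outside:
  fixes e :: "'a \<Rightarrow> real" and h M :: real
  assumes \<Omega>: "finite \<Omega>" "B \<subseteq> \<Omega>" and B: "\<And>x. x \<in> B \<Longrightarrow> e x \<le> M" "card B * M < card \<Omega> * h"
    and h: "0 \<le> h" "2 * h * card \<Omega> \<le> sum e \<Omega>"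
  obtains x where "x \<in> \<Omega> - B" "h \<le> e x"
proof (rule ccontr)
  assume "\<not> thesis"
  then have "\<forall>x\<in>\<Omega> - B. e x \<le> h" using that nle_le by blast
  have "sum e \<Omega> = sum e (\<Omega> - B) + sum e B" using \<Omega> by (rule sum.subset_diff[rotated])
  also have "\<dots> \<le> card (\<Omega> - B) * h + card B * M"
    using sum_bounded_above[of "\<Omega> - B" e h] sum_bounded_above[of B e M] B(1) \<open>\<forall>x\<in>\<Omega> - B. e x \<le> h\<close>
    by (simp add: add_mono)
  also have "card (\<Omega> - B) * h \<le> card \<Omega> * h"
    using \<Omega> h(1) by (intro mult_right_mono of_nat_mono card_mono) auto
  also have "card \<Omega> * h + card B * M < 2 * h * card \<Omega>" using B(2) by (simp add: mult_ac)
  finally show False using h(2) by simp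
qed

locale random_polys = finite_subfield F for F :: "'k::field set" +
  fixes dM dN r d :: nat and Z :: "(nat \<Rightarrow> 'k) set"
  assumes d: "2 \<le> d" and Z: "Z \<subseteq> PiE {..<r} (\<lambda>_. F)"
begin

definition W :: "(nat + nat) set" where "W = {..<dM} <+> {..<dN}"

definition polys :: "(nat \<Rightarrow> (nat + nat \<Rightarrow> 'k) \<Rightarrow> 'k) set" where
  "polys = PiE {..<r} (\<lambda>_. poly_funs W d)"

definition hits :: "(nat \<Rightarrow> (nat + nat \<Rightarrow> 'k) \<Rightarrow> 'k) \<Rightarrow> (nat + nat \<Rightarrow> 'k) \<Rightarrow> bool" where
  "hits f x \<longleftrightarrow> eval_all {..<r} f x \<in> Z"

lemma finite_W [simp]: "finite W"
  by (simp add: W_def)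

lemma finite_Z: "finite Z"
  by (rule finite_subset[OF Z]) (simp add: finite_PiE)

lemma finite_polys [simp]: "finite polys"
  by (simp add: polys_def finite_PiE finite_poly_funs)

lemma card_polys: "card polys = card (poly_funs W d) ^ r"
  by (simp add: polys_def card_PiE)

lemma card_polys_gt_0: "card polys > 0"
  using card_poly_funs_gt_0[OF finite_W] by (simp add: card_polys)

lemma polysD: "f \<in> polys \<Longrightarrow> \<rho> < r \<Longrightarrow> poly_fun W d (f \<rho>)"
  by (auto simp: polys_def dest: PiE_mem)

lemma hits_cong:
  assumes f: "f \<in> polys" and "\<And>w. w \<in> W \<Longrightarrow> x w = x' w"
  shows "hits f x \<longleftrightarrow> hits f x'"
proof -
  have "f \<rho> x = f \<rho> x'" if "\<rho> < r" for \<rho>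
    by (rule poly_fun_cong[OF polysD[OF f that]]) (rule assms(2))
  then show ?thesis by (simp add: hits_def eval_all_def cong: restrict_cong)
qed

lemma case_sum_inj_on_W:
  assumes "x \<in> PiE {..<dM} (\<lambda>_. F)" "x' \<in> PiE {..<dM} (\<lambda>_. F)"
    and "y \<in> PiE {..<dN} (\<lambda>_. F)" "y' \<in> PiE {..<dN} (\<lambda>_. F)"
    and eq: "\<And>w. w \<in> W \<Longrightarrow> case_sum x y w = case_sum x' y' w"
  shows "x = x'" "y = y'"
proof -
  show "x = x'"
    using assms(1,2) by (rule PiE_ext) (use eq[of "Inl i" for i] in \<open>simp add: W_def InlI\<close>)
  show "y = y'"
    using assms(3,4) by (rule PiE_ext) (use eq[of "Inr i" for i] in \<open>simp add: W_def InrI\<close>)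
qed

lemma card_polys_hitting:
  fixes P v :: "'a \<Rightarrow> nat + nat \<Rightarrow> 'k"
  assumes A: "finite A" "2 * card A \<le> d" and B: "B \<subseteq> A"
    and P: "\<And>a w. a \<in> A \<Longrightarrow> w \<in> W \<Longrightarrow> P a w \<in> F" "inj_on (\<lambda>a. restrict (P a) W) A"
    and v: "\<And>a w. a \<in> B \<Longrightarrow> w \<in> W \<Longrightarrow> v a w \<in> F" "\<And>a. a \<in> B \<Longrightarrow> \<exists>w\<in>W. v a w \<noteq> 0"
  shows "real (card
      {f \<in> polys. (\<forall>a\<in>A. hits f (P a)) \<and> (\<forall>a\<in>B. \<forall>\<rho><r. dir_deriv (f \<rho>) (P a) (v a) = 0)}) =
    card polys * (real (card Z) / real (card F) ^ r) ^ card A * (1 / real (card F) ^ (r * card B))"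
    (is "real (card ?S) = _")
proof -
  have nonempty: "F \<noteq> {}" using zero_in by blast
  have "card ?S * card F ^ (r * (card A + card B)) = card Z ^ card A * card polys"
    using card_poly_tuples_hitting[OF finite_W A B P v finite_lessThan Z]
    by (simp add: polys_def hits_def Ball_def card_PiE)
  then have
    "real (card ?S * card F ^ (r * (card A + card B))) = real (card Z ^ card A * card polys)"
    by (simp only:)
  then show ?thesis
    using nonempty by (simp add: field_simps power_add power_mult power_divide)
qed

lemma card_hits:
  assumes "\<And>w. w \<in> W \<Longrightarrow> x w \<in> F"
  shows "real (card {f \<in> polys. hits f x}) = real (card Z) / real (card F) ^ r * card polys"
  using card_polys_hitting[of "{()}" "{}" "\<lambda>_. x"] assms d by simp

lemma sum_card_hits:
  assumes PM: "PM \<subseteq> PiE {..<dM} (\<lambda>_. F)" and PN: "PN \<subseteq> PiE {..<dN} (\<lambda>_. F)"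
  shows "(\<Sum>f\<in>polys. real (card {q \<in> PM \<times> PN. hits f (case_prod case_sum q)})) =
    real (card PM) * real (card PN) * (real (card Z) / real (card F) ^ r) * card polys"
proof -
  have fin: "finite (PM \<times> PN)"
    using finite_subset[OF PM finite_PiE] finite_subset[OF PN finite_PiE] by simp
  have in_F: "case_prod case_sum q w \<in> F" if "q \<in> PM \<times> PN" "w \<in> W" for q w
    using that PiE_mem[OF subsetD[OF PM, of "fst q"]] PiE_mem[OF subsetD[OF PN, of "snd q"]]
    by (auto simp: W_def)
  have "(\<Sum>f\<in>polys. card {q \<in> PM \<times> PN. hits f (case_prod case_sum q)}) =
      (\<Sum>f\<in>polys. \<Sum>q\<in>PM \<times> PN. of_bool (hits f (case_prod case_sum q)))"
    using fin by (simp add: Int_def)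
  also have "\<dots> = (\<Sum>q\<in>PM \<times> PN. \<Sum>f\<in>polys. of_bool (hits f (case_prod case_sum q)))"
    by (rule sum.swap)
  also have "\<dots> = (\<Sum>q\<in>PM \<times> PN. card {f \<in> polys. hits f (case_prod case_sum q)})"
    by (simp add: Int_def)
  finally have "(\<Sum>f\<in>polys. real (card {q \<in> PM \<times> PN. hits f (case_prod case_sum q)})) =
      (\<Sum>q\<in>PM \<times> PN. real (card {f \<in> polys. hits f (case_prod case_sum q)}))"
    by (simp only: flip: of_nat_sum)
  also have "\<dots> = (\<Sum>q\<in>PM \<times> PN. real (card Z) / real (card F) ^ r * card polys)"
    using in_F by (intro sum.cong refl card_hits)
  finally show ?thesis by (simp add: card_cartesian_product)
qed

lemma exists_dense_outside:
  assumes PM: "PM \<subseteq> PiE {..<dM} (\<lambda>_. F)" "PM \<noteq> {}" and PN: "PN \<subseteq> PiE {..<dN} (\<lambda>_. F)" "PN \<noteq> {}"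
    and B: "B \<subseteq> polys" "2 * card B * card F ^ r < card Z * card polys"
  obtains f where "f \<in> polys - B"
    "1 / 2 * (real (card PM) * real (card PN) * (real (card Z) / real (card F) ^ r)) \<le>
      real (card {q \<in> PM \<times> PN. hits f (case_prod case_sum q)})"
proof (rule exists_large_outside[OF finite_polys B(1)])
  let ?h = "1 / 2 * (real (card PM) * real (card PN) * (real (card Z) / real (card F) ^ r))"
  have fin: "finite PM" "finite PN"
    using finite_subset[OF PM(1) finite_PiE] finite_subset[OF PN(1) finite_PiE] by simp_all
  have F_gt_0: "real (card F) > 0" using card_F_gt_1 by simp
  have pos: "0 < real (card PM) * real (card PN)" using fin PM PN by (simp add: card_gt_0_iff)
  show "real (card {q \<in> PM \<times> PN. hits f (case_prod case_sum q)}) \<le>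
      real (card PM) * real (card PN)" for f
    using card_mono[of "PM \<times> PN" "{q \<in> PM \<times> PN. hits f (case_prod case_sum q)}"] fin
    by (simp add: card_cartesian_product flip: of_nat_mult)
  have "real (2 * card B * card F ^ r) < real (card Z * card polys)" using B(2) by linarith
  then have "real (card B) < card polys * (1 / 2 * (real (card Z) / real (card F) ^ r))"
    using F_gt_0 by (simp add: field_simps)
  from mult_strict_right_mono[OF this pos]
  show "card B * (real (card PM) * real (card PN)) < card polys * ?h"
    by (simp only: mult_ac)
  show "0 \<le> ?h" using pos by simp
  show "2 * ?h * card polys \<le> (\<Sum>f\<in>polys. real (card {q \<in> PM \<times> PN. hits f (case_prod case_sum q)}))"
    unfolding sum_card_hits[OF PM(1) PN(1)] by simp
qed

end

section \<open>Balanced templates\<close>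

text \<open>
  A template is a bipartite graph with a set \<open>R\<close> of roots and a set \<open>I\<close> of other vertices. An edge
  is the pair of its endpoint in \<open>M\<close>, a point of dimension \<open>dM\<close>, and its endpoint in \<open>N\<close>, a point
  of dimension \<open>dN\<close>; it imposes \<open>r\<close> equations.
\<close>

locale balanced_template =
  fixes R I :: "'v set" and E :: "('v \<times> 'v) set" and dim :: "'v \<Rightarrow> nat" and dM dN r :: nat
  assumes finite_R: "finite R" and finite_I: "finite I" and disjoint: "R \<inter> I = {}"
    and E_nonempty: "E \<noteq> {}"
    and edge: "(u, v) \<in> E \<Longrightarrow> u \<in> R \<union> I \<and> v \<in> R \<union> I \<and> dim u = dM \<and> dim v = dN"
    and balanced: "S \<subseteq> I \<Longrightarrow> sum dim S \<le> r * card {e \<in> E. fst e \<in> S \<or> snd e \<in> S}"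
begin

definition touching :: "'v set \<Rightarrow> ('v \<times> 'v) set" where
  "touching S = {e \<in> E. fst e \<in> S \<or> snd e \<in> S}"

definition coords :: "'v set \<Rightarrow> ('v \<times> nat) set" where
  "coords A = (SIGMA u:A. {..<dim u})"

definition support :: "('v \<times> nat \<Rightarrow> 'a::zero) \<Rightarrow> 'v set" where
  "support v = {u \<in> I. \<exists>i<dim u. v (u, i) \<noteq> 0}"

lemma finite_E [simp]: "finite E"
  by (rule finite_subset[of _ "(R \<union> I) \<times> (R \<union> I)"]) (use edge finite_R finite_I in auto)

lemma touching_subset: "touching S \<subseteq> E"
  by (auto simp: touching_def)

lemma finite_touching [simp]: "finite (touching S)"
  using finite_subset[OF touching_subset finite_E] .

lemma finite_coords_R [simp]: "finite (coords R)" and finite_coords_I [simp]: "finite (coords I)"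
  using finite_R finite_I by (auto simp: coords_def)

lemma card_coords: "finite A \<Longrightarrow> card (coords A) = sum dim A"
  by (simp add: coords_def card_SigmaI)

lemma card_coords_le_touching: "S \<subseteq> I \<Longrightarrow> card (coords S) \<le> r * card (touching S)"
  using balanced[of S] finite_subset[OF _ finite_I, of S] by (simp add: card_coords touching_def)

lemma card_coords_I_le: "card (coords I) \<le> r * card E"
  using card_coords_le_touching[OF order_refl] card_mono[OF finite_E touching_subset]
  by (meson mult_le_mono2 order_trans)

end

locale template_construction =
  random_polys F dM dN r d Z + balanced_template R I E dim dM dN r
  for F :: "'k::field set" and dM dN r d :: nat and Z :: "(nat \<Rightarrow> 'k) set"
    and R I :: "'v set" and E :: "('v \<times> 'v) set" and dim :: "'v \<Rightarrow> nat" +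
  fixes T :: nat
  assumes degree: "2 * (T * card E) \<le> d"
begin

text \<open>
  The coordinates of a placement of the template are split into those of the roots, \<open>y\<close>, and those
  of the other vertices, \<open>x\<close>.
\<close>

definition place ::
  "('v \<times> nat \<Rightarrow> 'k) \<Rightarrow> ('v \<times> nat \<Rightarrow> 'k) \<Rightarrow> 'v \<times> nat \<Rightarrow> 'k" where
  "place y x = override_on y x (coords I)"

definition edge_pt :: "('v \<times> nat \<Rightarrow> 'k) \<Rightarrow> 'v \<times> 'v \<Rightarrow> nat + nat \<Rightarrow> 'k" where
  "edge_pt Y e = case_sum (curry Y (fst e)) (curry Y (snd e))"

definition equation :: "(nat \<Rightarrow> (nat + nat \<Rightarrow> 'k) \<Rightarrow> 'k) \<Rightarrow> ('v \<times> nat \<Rightarrow> 'k) \<Rightarrow>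
    ('v \<times> 'v) \<times> nat \<Rightarrow> ('v \<times> nat \<Rightarrow> 'k) \<Rightarrow> 'k" where
  "equation f y q x = f (snd q) (edge_pt (place y x) (fst q))"

abbreviation equations :: "(('v \<times> 'v) \<times> nat) set" where
  "equations \<equiv> E \<times> {..<r}"

definition singular :: "(nat \<Rightarrow> (nat + nat \<Rightarrow> 'k) \<Rightarrow> 'k) \<Rightarrow>
    ('v \<times> nat \<Rightarrow> 'k) \<Rightarrow> ('v \<times> nat \<Rightarrow> 'k) \<Rightarrow> bool" where
  "singular f y x \<longleftrightarrow> \<not> nonsingular (coords I) equations (equation f y) x"

definition sunflower :: "(nat \<Rightarrow> (nat + nat \<Rightarrow> 'k) \<Rightarrow> 'k) \<Rightarrow> 'j set \<Rightarrow>
    ('v \<times> nat \<Rightarrow> 'k) \<Rightarrow> ('j \<Rightarrow> 'v \<times> nat \<Rightarrow> 'k) \<Rightarrow> bool" where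
  "sunflower f J y x \<longleftrightarrow>
    y \<in> PiE (coords R) (\<lambda>_. F) \<and> (\<forall>j\<in>J. x j \<in> PiE (coords I) (\<lambda>_. F)) \<and>
    (\<forall>j\<in>J. \<forall>e\<in>E. hits f (edge_pt (place y (x j)) e)) \<and>
    inj_on (\<lambda>(j, e). restrict (edge_pt (place y (x j)) e) W) (J \<times> E)"

definition degenerate :: "(nat \<Rightarrow> (nat + nat \<Rightarrow> 'k) \<Rightarrow> 'k) \<Rightarrow> bool" where
  "degenerate f \<longleftrightarrow> (\<exists>y x. sunflower f {..<T} y x \<and> (\<forall>j<T. singular f y (x j)))"

lemma edge_pt_coordinate:
  assumes "e \<in> E" "w \<in> W"
  shows "\<exists>u\<in>coords (R \<union> I). \<forall>Y. edge_pt Y e w = Y u"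
proof (cases w)
  case (Inl i)
  then have "(fst e, i) \<in> coords (R \<union> I)"
    using assms edge[of "fst e" "snd e"] by (auto simp: W_def coords_def)
  then show ?thesis using Inl by (auto simp: edge_pt_def)
next
  case (Inr i)
  then have "(snd e, i) \<in> coords (R \<union> I)"
    using assms edge[of "fst e" "snd e"] by (auto simp: W_def coords_def)
  then show ?thesis using Inr by (auto simp: edge_pt_def)
qed

lemma edge_pt_place_in:
  assumes "e \<in> E" "w \<in> W" "\<And>u. u \<in> coords R \<Longrightarrow> y u \<in> F" "\<And>u. u \<in> coords I \<Longrightarrow> x u \<in> F"
  shows "edge_pt (place y x) e w \<in> F"
proof -
  obtain u where u: "u \<in> coords (R \<union> I)" "edge_pt (place y x) e w = place y x u"
    using edge_pt_coordinate[OF assms(1,2)] by blast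
  then have "u \<in> coords R \<or> u \<in> coords I" by (auto simp: coords_def)
  then show ?thesis using assms(3,4) u(2) by (cases "u \<in> coords I") (auto simp: place_def)
qed

lemma edge_pt_place_line:
  "edge_pt (place y (\<lambda>u. x u + \<tau> * v u)) e =
    (\<lambda>w. edge_pt (place y x) e w + \<tau> * edge_pt (place (\<lambda>_. 0) v) e w)"
  by (auto simp: fun_eq_iff edge_pt_def place_def override_on_def split: sum.split)

lemma dir_deriv_equation:
  "dir_deriv (equation f y (e, \<rho>)) x v =
    dir_deriv (f \<rho>) (edge_pt (place y x) e) (edge_pt (place (\<lambda>_. 0) v) e)"
  by (simp add: dir_deriv_def equation_def edge_pt_place_line)

lemma poly_fun_equation:
  assumes f: "f \<in> polys" and y: "y \<in> PiE (coords R) (\<lambda>_. F)" and q: "q \<in> equations"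
  shows "poly_fun (coords I) d (equation f y q)"
proof -
  have "poly_fun (coords I) d (\<lambda>x. f (snd q) (\<lambda>w. edge_pt (place y x) (fst q) w))"
  proof (rule poly_fun_subst[where \<sigma> = "\<lambda>w x. edge_pt (place y x) (fst q) w"])
    show "poly_fun W d (f (snd q))" using polysD[OF f] q by auto
    fix w assume "w \<in> W"
    then obtain u where u: "u \<in> coords (R \<union> I)" "\<forall>Y. edge_pt Y (fst q) w = Y u"
      using edge_pt_coordinate[of "fst q" w] q by auto
    show "(\<exists>i\<in>coords I. (\<lambda>x. edge_pt (place y x) (fst q) w) = (\<lambda>x. x i)) \<or>
      (\<exists>c\<in>F. (\<lambda>x. edge_pt (place y x) (fst q) w) = (\<lambda>x. c))"
    proof (cases "u \<in> coords I")
      case False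
      then have "y u \<in> F" using u(1) PiE_mem[OF y] by (auto simp: coords_def)
      then show ?thesis using False by (auto simp: u(2) place_def)
    qed (auto simp: u(2) place_def)
  qed
  then show ?thesis by (simp add: equation_def[abs_def])
qed

lemma edge_direction_nonzero:
  assumes "e \<in> touching (support v)"
  shows "\<exists>w\<in>W. edge_pt (place (\<lambda>_. 0) v) e w \<noteq> 0"
proof -
  have "fst e \<in> support v \<or> snd e \<in> support v" using assms by (auto simp: touching_def)
  then obtain u where "u = fst e \<or> u = snd e" "u \<in> support v" by blast
  then obtain i where ui: "u = fst e \<or> u = snd e" "u \<in> I" "i < dim u" "v (u, i) \<noteq> 0"
    by (auto simp: support_def)
  have "place (\<lambda>_. 0) v (u, i) = v (u, i)" using ui by (simp add: place_def coords_def)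
  moreover have "dim (fst e) = dM" "dim (snd e) = dN"
    using subsetD[OF touching_subset assms] edge[of "fst e" "snd e"] by auto
  ultimately show ?thesis
    using ui by (intro bexI[of _ "if u = fst e then Inl i else Inr i"])
                (auto simp: edge_pt_def W_def split: if_splits)
qed

lemma sunflowerI:
  fixes P :: "'j \<Rightarrow> 'v \<Rightarrow> nat \<Rightarrow> 'k"
  assumes f: "f \<in> polys" and j0: "j0 \<in> J"
    and P: "\<And>j u. j \<in> J \<Longrightarrow> u \<in> R \<union> I \<Longrightarrow> P j u \<in> PiE {..<dim u} (\<lambda>_. F)"
    and root: "\<And>j u. j \<in> J \<Longrightarrow> u \<in> R \<Longrightarrow> P j u = P j0 u"
    and hit: "\<And>j u v. j \<in> J \<Longrightarrow> (u, v) \<in> E \<Longrightarrow> hits f (case_sum (P j u) (P j v))"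
    and inj: "\<And>j u v j' u' v'. j \<in> J \<Longrightarrow> j' \<in> J \<Longrightarrow> (u, v) \<in> E \<Longrightarrow> (u', v') \<in> E \<Longrightarrow>
      P j u = P j' u' \<Longrightarrow> P j v = P j' v' \<Longrightarrow> j = j' \<and> u = u' \<and> v = v'"
  shows "sunflower f J (\<lambda>(u, i)\<in>coords R. P j0 u i) (\<lambda>j. \<lambda>(u, i)\<in>coords I. P j u i)"
    (is "sunflower f J ?y ?x")
proof -
  have edge_pt: "edge_pt (place ?y (?x j)) (u, v) w = case_sum (P j u) (P j v) w"
    if "j \<in> J" "(u, v) \<in> E" "w \<in> W" for j u v w
  proof -
    have "place ?y (?x j) (u, i) = P j u i" if "u \<in> R \<union> I" "i < dim u" for u i
      using that root[OF \<open>j \<in> J\<close>] disjoint by (auto simp: place_def coords_def override_on_def)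
    then show ?thesis
      using edge[OF that(2)] that(3) by (auto simp: edge_pt_def W_def)
  qed
  have "inj_on (\<lambda>(j, e). restrict (edge_pt (place ?y (?x j)) e) W) (J \<times> E)"
  proof (rule inj_onI)
    fix q q' assume "q \<in> J \<times> E" "q' \<in> J \<times> E"
      and eq_q: "(\<lambda>(j, e). restrict (edge_pt (place ?y (?x j)) e) W) q =
        (\<lambda>(j, e). restrict (edge_pt (place ?y (?x j)) e) W) q'"
    then obtain j u v j' u' v' where q: "q = (j, u, v)" "q' = (j', u', v')"
      and j: "j \<in> J" "j' \<in> J" and e: "(u, v) \<in> E" "(u', v') \<in> E" by (auto elim!: SigmaE)
    have "restrict (edge_pt (place ?y (?x j)) (u, v)) W =
        restrict (edge_pt (place ?y (?x j')) (u', v')) W"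
      using eq_q by (simp only: q prod.case)
    then have eq: "case_sum (P j u) (P j v) w = case_sum (P j' u') (P j' v') w" if "w \<in> W" for w
      using edge_pt[OF j(1) e(1) that] edge_pt[OF j(2) e(2) that] that by (metis restrict_apply')
    have "P j u \<in> PiE {..<dM} (\<lambda>_. F)" "P j' u' \<in> PiE {..<dM} (\<lambda>_. F)"
      "P j v \<in> PiE {..<dN} (\<lambda>_. F)" "P j' v' \<in> PiE {..<dN} (\<lambda>_. F)"
      using P j e edge by metis+
    from case_sum_inj_on_W[OF this eq] show "q = q'" using inj[OF j e] by (simp add: q)
  qed
  moreover have "hits f (edge_pt (place ?y (?x j)) (u, v))" if "j \<in> J" "(u, v) \<in> E" for j u v
    using hit[OF that] edge_pt[OF that]
      hits_cong[OF f, of "edge_pt (place ?y (?x j)) (u, v)" "case_sum (P j u) (P j v)"] by simp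
  moreover have "P j u i \<in> F" if "j \<in> J" "u \<in> R \<union> I" "i < dim u" for j u i
    using PiE_mem[OF P[OF that(1,2)], of i] that(3) by simp
  ultimately show ?thesis using j0 by (auto simp: sunflower_def coords_def)
qed

section \<open>Singular sunflowers are rare\<close>

definition directions :: "('v \<times> nat \<Rightarrow> 'k) set" where
  "directions = {v \<in> PiE (coords I) (\<lambda>_. F). \<exists>i\<in>coords I. v i = 1}"

definition direction_weight :: "('v \<times> nat \<Rightarrow> 'k) \<Rightarrow> real" where
  "direction_weight v = 1 / real (card F) ^ (r * card (touching (support v)))"

lemma finite_directions [simp]: "finite directions"
  by (rule finite_subset[of _ "PiE (coords I) (\<lambda>_. F)"]) (auto simp: directions_def finite_PiE)

lemma card_directions_with_support:
  assumes S: "S \<subseteq> I"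
  shows "card {v \<in> directions. support v = S} * card F \<le>
    card (coords I) * card F ^ card (coords S)"
proof -
  let ?B = "\<lambda>i. PiE (coords I) (\<lambda>w. if w = i then {1} else if w \<in> coords S then F else {0 :: 'k})"
  have coords_S: "coords S \<subseteq> coords I" using S by (auto simp: coords_def)
  have fin: "finite (coords S)" using coords_S by (rule finite_subset) simp
  have "{v \<in> directions. support v = S} \<subseteq> (\<Union>i\<in>coords S. ?B i)"
  proof
    fix v assume "v \<in> {v \<in> directions. support v = S}"
    then obtain i where v: "v \<in> PiE (coords I) (\<lambda>_. F)" "support v = S" "i \<in> coords I" "v i = 1"
      by (auto simp: directions_def)
    have zero: "w \<in> coords S" if "w \<in> coords I" "v w \<noteq> 0" for w
      using that v(2) by (cases w) (auto simp: support_def coords_def)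
    have "v \<in> ?B i" using v(1,4) zero by (auto simp: PiE_iff)
    then show "v \<in> (\<Union>i\<in>coords S. ?B i)" using zero[OF v(3)] v(4) by auto
  qed
  then have "card {v \<in> directions. support v = S} \<le> card (\<Union>i\<in>coords S. ?B i)"
    using fin by (intro card_mono finite_UN_I finite_PiE) auto
  also have "\<dots> \<le> (\<Sum>i\<in>coords S. card (?B i))" by (rule card_UN_le[OF fin])
  finally have "card {v \<in> directions. support v = S} * card F \<le> (\<Sum>i\<in>coords S. card (?B i)) * card F"
    by (rule mult_right_mono) simp
  also have "\<dots> = card (coords S) * card F ^ card (coords S)"
    using card_pinned_functions[OF finite_coords_I coords_S] by (simp add: sum_distrib_right)
  also have "\<dots> \<le> card (coords I) * card F ^ card (coords S)"
    using coords_S by (intro mult_right_mono card_mono) auto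
  finally show ?thesis .
qed

text \<open>
  Kernel vectors may be normalised to have an entry \<open>1\<close>. This gains the factor \<open>card F\<close>, since the
  remaining entries are paid for by the equations because the template is balanced.
\<close>

lemma sum_direction_weight:
  "(\<Sum>v\<in>directions. direction_weight v) \<le> 2 ^ card I * card (coords I) / card F"
proof -
  have F_gt_0: "real (card F) > 0" using card_F_gt_1 by simp
  have "(\<Sum>v\<in>directions. direction_weight v) =
      (\<Sum>S\<in>Pow I. \<Sum>v\<in>{v \<in> directions. support v = S}. direction_weight v)"
    using finite_I by (subst sum.group) (auto simp: support_def)
  also have "\<dots> \<le> (\<Sum>S\<in>Pow I. card (coords I) / card F)"
  proof (rule sum_mono)
    fix S assume "S \<in> Pow I"
    then have S: "S \<subseteq> I" by simp
    have "real (card {v \<in> directions. support v = S} * card F) \<le>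
        real (card (coords I) * card F ^ card (coords S))"
      using card_directions_with_support[OF S] by (simp only: of_nat_le_iff)
    also have "\<dots> \<le> card (coords I) * real (card F) ^ (r * card (touching S))"
      using card_coords_le_touching[OF S] card_F_gt_1 by (simp add: mult_left_mono power_increasing)
    finally show "(\<Sum>v\<in>{v \<in> directions. support v = S}. direction_weight v) \<le>
        card (coords I) / card F"
      using F_gt_0 by (simp add: direction_weight_def field_simps)
  qed
  also have "\<dots> = 2 ^ card I * card (coords I) / card F"
    using finite_I by (simp add: card_Pow)
  finally show ?thesis .
qed

definition singular_along :: "('v \<times> nat \<Rightarrow> 'k) \<Rightarrow> (nat \<Rightarrow> 'v \<times> nat \<Rightarrow> 'k) \<Rightarrow>
    (nat \<Rightarrow> 'v \<times> nat \<Rightarrow> 'k) \<Rightarrow> (nat \<Rightarrow> (nat + nat \<Rightarrow> 'k) \<Rightarrow> 'k) set" where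
  "singular_along y x v = {f \<in> polys. sunflower f {..<T} y x \<and>
    (\<forall>j<T. \<forall>q\<in>equations. dir_deriv (equation f y q) (x j) (v j) = 0)}"

lemma card_singular_along:
  assumes v: "v \<in> PiE {..<T} (\<lambda>_. directions)"
  shows "card (singular_along y x v) \<le>
    card polys * (real (card Z) / real (card F) ^ r) ^ (T * card E) *
    (\<Prod>j<T. direction_weight (v j))"
proof (cases "singular_along y x v = {}")
  case True
  then show ?thesis by (simp add: prod_nonneg direction_weight_def)
next
  case False
  then obtain f where "sunflower f {..<T} y x" by (auto simp: singular_along_def)
  then have y: "\<And>u. u \<in> coords R \<Longrightarrow> y u \<in> F"
    and x: "\<And>j u. j < T \<Longrightarrow> u \<in> coords I \<Longrightarrow> x j u \<in> F"
    and inj: "inj_on (\<lambda>(j, e). restrict (edge_pt (place y (x j)) e) W) ({..<T} \<times> E)"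
    by (auto simp: sunflower_def dest: PiE_mem)
  have v_in: "v j u \<in> F" if "j < T" "u \<in> coords I" for j u
    using PiE_mem[OF v, of j] that by (auto simp: directions_def)
  let ?A = "{..<T} \<times> E" and ?B = "SIGMA j:{..<T}. touching (support (v j))"
  let ?P = "\<lambda>(j, e). edge_pt (place y (x j)) e" and ?v = "\<lambda>(j, e). edge_pt (place (\<lambda>_. 0) (v j)) e"
  let ?S = "{f \<in> polys. (\<forall>a\<in>?A. hits f (?P a)) \<and> (\<forall>a\<in>?B. \<forall>\<rho><r. dir_deriv (f \<rho>) (?P a) (?v a) = 0)}"
  have "singular_along y x v \<subseteq> ?S"
    using touching_subset by (fastforce simp: singular_along_def sunflower_def dir_deriv_equation)
  then have "real (card (singular_along y x v)) \<le> real (card ?S)"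
    by (intro of_nat_mono card_mono) auto
  also have "real (card ?S) = card polys * (real (card Z) / real (card F) ^ r) ^ card ?A *
      (1 / real (card F) ^ (r * card ?B))"
  proof (rule card_polys_hitting)
    show "2 * card ?A \<le> d" using degree by (simp add: card_cartesian_product)
    show "?B \<subseteq> ?A" using touching_subset by auto
    show "?P a w \<in> F" if "a \<in> ?A" "w \<in> W" for a w
      using that y x by (auto intro!: edge_pt_place_in)
    show "inj_on (\<lambda>a. restrict (?P a) W) ?A" using inj by (simp add: case_prod_unfold)
    show "?v a w \<in> F" if "a \<in> ?B" "w \<in> W" for a w
      using that v_in subsetD[OF touching_subset] by (auto intro!: edge_pt_place_in)
    show "\<exists>w\<in>W. ?v a w \<noteq> 0" if "a \<in> ?B" for a using that edge_direction_nonzero by auto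
  qed simp
  also have "1 / real (card F) ^ (r * card ?B) = (\<Prod>j<T. direction_weight (v j))"
    by (simp add: direction_weight_def card_SigmaI sum_distrib_left power_sum prod_dividef)
  finally show ?thesis by (simp add: card_cartesian_product)
qed

abbreviation configurations ::
  "(('v \<times> nat \<Rightarrow> 'k) \<times> (nat \<Rightarrow> 'v \<times> nat \<Rightarrow> 'k) \<times> (nat \<Rightarrow> 'v \<times> nat \<Rightarrow> 'k)) set" where
  "configurations \<equiv> PiE (coords R) (\<lambda>_. F) \<times> PiE {..<T} (\<lambda>_. PiE (coords I) (\<lambda>_. F)) \<times>
    PiE {..<T} (\<lambda>_. directions)"

lemma degenerate_subset_singular_along:
  "{f \<in> polys. degenerate f} \<subseteq> (\<Union>(y, x, v)\<in>configurations. singular_along y x v)"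
proof
  fix f assume "f \<in> {f \<in> polys. degenerate f}"
  then obtain y x where f: "f \<in> polys" and sun: "sunflower f {..<T} y x"
    and sing: "\<And>j. j < T \<Longrightarrow> singular f y (x j)"
    by (auto simp: degenerate_def)
  have y: "y \<in> PiE (coords R) (\<lambda>_. F)" using sun by (simp add: sunflower_def)
  have "\<exists>v\<in>directions. \<forall>q\<in>equations. dir_deriv (equation f y q) (x j) v = 0" if "j < T" for j
  proof -
    have "\<not> nonsingular (coords I) equations (equation f y) (x j)"
      using sing[OF that] by (simp add: singular_def)
    from singular_kernel_vector[OF finite_coords_I _ this, of d] poly_fun_equation[OF f y]
    show ?thesis by (auto simp: directions_def)
  qed
  then obtain v where v: "\<And>j. j < T \<Longrightarrow> v j \<in> directions"
    "\<And>j q. j < T \<Longrightarrow> q \<in> equations \<Longrightarrow> dir_deriv (equation f y q) (x j) (v j) = 0"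
    by metis
  have "sunflower f {..<T} y (restrict x {..<T})"
    using sun unfolding sunflower_def by (auto simp: inj_on_def)
  then have "f \<in> singular_along y (restrict x {..<T}) (restrict v {..<T})"
    using f v(2) by (simp add: singular_along_def)
  moreover have "restrict x {..<T} \<in> PiE {..<T} (\<lambda>_. PiE (coords I) (\<lambda>_. F))"
    using sun by (auto simp: sunflower_def)
  moreover have "restrict v {..<T} \<in> PiE {..<T} (\<lambda>_. directions)" using v(1) by auto
  ultimately show "f \<in> (\<Union>(y, x, v)\<in>configurations. singular_along y x v)" using y by blast
qed

lemma sum_configuration_weight:
  "(\<Sum>(y, x, v)\<in>configurations. \<Prod>j<T. direction_weight (v j)) \<le>
    card F ^ card (coords R) * card F ^ (T * (r * card E)) *
    (2 ^ card I * card (coords I) / card F) ^ T"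
proof -
  let ?V = "PiE {..<T} (\<lambda>_. directions)"
  have "(\<Sum>(y, x, v)\<in>configurations. \<Prod>j<T. direction_weight (v j)) =
      real (card F) ^ card (coords R) * real (card F) ^ (T * card (coords I)) *
      (\<Sum>v\<in>?V. \<Prod>j<T. direction_weight (v j))"
    by (simp add: card_PiE power_mult mult.commute[of T] mult.assoc flip: sum.cartesian_product)
  also have "(\<Sum>v\<in>?V. \<Prod>j<T. direction_weight (v j)) = (\<Sum>v\<in>directions. direction_weight v) ^ T"
    by (subst prod_sum_PiE[symmetric]) auto
  also have "real (card F) ^ card (coords R) * real (card F) ^ (T * card (coords I)) *
      (\<Sum>v\<in>directions. direction_weight v) ^ T \<le>
      real (card F) ^ card (coords R) * real (card F) ^ (T * (r * card E)) *
      (2 ^ card I * card (coords I) / card F) ^ T"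
    using sum_direction_weight card_F_gt_1 card_coords_I_le
    by (intro mult_mono mult_nonneg_nonneg power_mono power_increasing)
       (auto simp: direction_weight_def sum_nonneg)
  finally show ?thesis by simp
qed

lemma card_degenerate:
  "card {f \<in> polys. degenerate f} \<le> card polys * real (card Z) ^ (T * card E) *
    card F ^ card (coords R) * (2 ^ card I * card (coords I) / card F) ^ T"
proof -
  define c where "c = card polys * (real (card Z) / real (card F) ^ r) ^ (T * card E)"
  have F_gt_0: "real (card F) > 0" using card_F_gt_1 by simp
  have fin: "finite configurations" by (intro finite_cartesian_product finite_PiE) auto
  have "finite (\<Union>(y, x, v)\<in>configurations. singular_along y x v)"
    by (rule finite_subset[OF _ finite_polys]) (auto simp: singular_along_def)
  then have "card {f \<in> polys. degenerate f} \<le>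
      card (\<Union>(y, x, v)\<in>configurations. singular_along y x v)"
    using degenerate_subset_singular_along by (rule card_mono)
  also have "\<dots> \<le> (\<Sum>(y, x, v)\<in>configurations. card (singular_along y x v))"
    using card_UN_le[OF fin] by (simp add: case_prod_unfold)
  finally have "real (card {f \<in> polys. degenerate f}) \<le>
      (\<Sum>(y, x, v)\<in>configurations. real (card (singular_along y x v)))"
    by (simp add: case_prod_unfold flip: of_nat_sum)
  also have "\<dots> \<le> (\<Sum>(y, x, v)\<in>configurations. c * (\<Prod>j<T. direction_weight (v j)))"
    unfolding c_def by (intro sum_mono) (auto intro!: card_singular_along)
  also have "\<dots> = c * (\<Sum>(y, x, v)\<in>configurations. \<Prod>j<T. direction_weight (v j))"
    by (simp add: sum_distrib_left case_prod_unfold)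
  also have "\<dots> \<le> c * (card F ^ card (coords R) * card F ^ (T * (r * card E)) *
      (2 ^ card I * card (coords I) / card F) ^ T)"
    by (rule mult_left_mono[OF sum_configuration_weight]) (simp add: c_def)
  also have "\<dots> = card polys * real (card Z) ^ (T * card E) *
      card F ^ card (coords R) * (2 ^ card I * card (coords I) / card F) ^ T"
    using F_gt_0 by (simp add: c_def power_divide power_mult[symmetric] mult_ac)
  finally show ?thesis .
qed

section \<open>Large sunflowers contain many singular copies\<close>

definition nonsingular_bound :: nat where
  "nonsingular_bound =
    2 ^ (card E * r) * (((card (coords I) + 1) * d) ^ card (coords I)) ^ card (coords I)"

lemma nonsingular_solutions_bounded:
  fixes z :: "'v \<times> 'v \<Rightarrow> nat \<Rightarrow> 'k"
  assumes f: "f \<in> polys" and y: "y \<in> PiE (coords R) (\<lambda>_. F)" and z: "z \<in> PiE E (\<lambda>_. Z)"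
    and F: "((card (coords I) + 1) * d) ^ card (coords I) < card F"
    and S: "S \<subseteq> PiE (coords I) (\<lambda>_. F)" "\<And>x. x \<in> S \<Longrightarrow> \<not> singular f y x"
      "\<And>x e \<rho>. x \<in> S \<Longrightarrow> e \<in> E \<Longrightarrow> \<rho> < r \<Longrightarrow> equation f y (e, \<rho>) x = z e \<rho>"
  shows "card S \<le> nonsingular_bound"
proof -
  define g where "g q x = equation f y q x - z (fst q) (snd q)" for q x
  have "z e \<rho> \<in> F" if "e \<in> E" "\<rho> < r" for e \<rho>
    using PiE_mem[OF z that(1)] Z that(2) by (auto dest: PiE_mem)
  then have g: "poly_fun (coords I) d (g q)" if "q \<in> equations" for q
    unfolding g_def using that
    by (intro poly_fun_diff poly_fun.const poly_fun_equation[OF f y]) auto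
  have "nonsingular (coords I) equations g x \<longleftrightarrow>
      nonsingular (coords I) equations (equation f y) x" for x
    unfolding g_def
    by (rule nonsingular_cong) (rule dir_deriv_diff_const[OF poly_fun_equation[OF f y]])
  then have "S \<subseteq> nonsingular_zeros (coords I) equations g"
    using S by (auto simp: nonsingular_zeros_def singular_def g_def)
  then have "card S \<le> card (nonsingular_zeros (coords I) equations g)"
    by (intro card_mono finite_nonsingular_zeros) auto
  also have "\<dots> \<le> nonsingular_bound"
    using card_nonsingular_zeros[OF finite_coords_I _ _ _ order_refl F, of equations g] g d
    by (simp add: card_cartesian_product nonsingular_bound_def)
  finally show ?thesis .
qed

definition sunflower_bound :: nat where
  "sunflower_bound = card Z ^ card E * nonsingular_bound"

lemma inj_sunflower:
  assumes "sunflower f J y x"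
  shows "inj_on x J"
proof (rule inj_onI)
  fix j j' assume "j \<in> J" "j' \<in> J" "x j = x j'"
  moreover obtain e where "e \<in> E" using E_nonempty by blast
  moreover have "inj_on (\<lambda>(j, e). restrict (edge_pt (place y (x j)) e) W) (J \<times> E)"
    using assms by (simp add: sunflower_def)
  ultimately show "j = j'" by (auto dest!: inj_onD[of _ _ "(j, e)" "(j', e)"])
qed

lemma card_nonsingular_sunflower:
  assumes f: "f \<in> polys" and sun: "sunflower f J y x" and J: "finite J"
    and nonsing: "\<And>j. j \<in> J \<Longrightarrow> \<not> singular f y (x j)"
    and F: "((card (coords I) + 1) * d) ^ card (coords I) < card F"
  shows "card J \<le> sunflower_bound"
proof -
  define pattern where "pattern j = (\<lambda>e\<in>E. eval_all {..<r} f (edge_pt (place y (x j)) e))" for j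
  have pattern_in: "pattern ` J \<subseteq> PiE E (\<lambda>_. Z)"
    using sun by (auto simp: pattern_def sunflower_def hits_def)
  have fibre: "card {j \<in> J. pattern j = z} \<le> nonsingular_bound" if z: "z \<in> PiE E (\<lambda>_. Z)" for z
  proof -
    have "card (x ` {j \<in> J. pattern j = z}) \<le> nonsingular_bound"
    proof (rule nonsingular_solutions_bounded[OF f _ z F])
      show "y \<in> PiE (coords R) (\<lambda>_. F)"
        "x ` {j \<in> J. pattern j = z} \<subseteq> PiE (coords I) (\<lambda>_. F)"
        using sun by (auto simp: sunflower_def)
    qed (use nonsing in \<open>auto simp: pattern_def equation_def eval_all_def\<close>)
    moreover have "inj_on x {j \<in> J. pattern j = z}"
      using inj_sunflower[OF sun] by (rule inj_on_subset) auto
    ultimately show ?thesis by (simp add: card_image)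
  qed
  have fin: "finite (PiE E (\<lambda>_. Z))" using finite_Z by (intro finite_PiE) auto
  have "card J = (\<Sum>z\<in>PiE E (\<lambda>_. Z). card {j \<in> J. pattern j = z})"
    using sum.group[OF J fin pattern_in, of "\<lambda>_. 1 :: nat"] by simp
  also have "\<dots> \<le> card (PiE E (\<lambda>_. Z)) * nonsingular_bound"
    using sum_bounded_above[OF fibre] by simp
  also have "\<dots> = sunflower_bound" by (simp add: sunflower_bound_def card_PiE)
  finally show ?thesis .
qed

lemma sunflower_subset:
  "sunflower f J y x \<Longrightarrow> J' \<subseteq> J \<Longrightarrow> sunflower f J' y x"
  by (auto simp: sunflower_def intro: inj_on_subset)

lemma sunflower_reindex:
  assumes "sunflower f (h ` J) y x" "inj_on h J"
  shows "sunflower f J y (x \<circ> h)"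
proof -
  have "inj_on (map_prod h id) (J \<times> E)" using assms(2) by (auto simp: inj_on_def)
  moreover have "inj_on (\<lambda>(j, e). restrict (edge_pt (place y (x j)) e) W) (map_prod h id ` (J \<times> E))"
    using assms(1) by (auto simp: sunflower_def map_prod_surj_on)
  ultimately have
    "inj_on ((\<lambda>(j, e). restrict (edge_pt (place y (x j)) e) W) \<circ> map_prod h id) (J \<times> E)"
    by (rule comp_inj_on)
  then show ?thesis using assms(1) by (simp add: sunflower_def comp_def case_prod_unfold)
qed

lemma card_sunflower:
  assumes f: "f \<in> polys" "\<not> degenerate f" and sun: "sunflower f J y x" and J: "finite J"
    and F: "((card (coords I) + 1) * d) ^ card (coords I) < card F"
  shows "card J < T + sunflower_bound"
proof -
  define J' where "J' = {j \<in> J. singular f y (x j)}"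
  have J': "finite J'" "J' \<subseteq> J" using J by (auto simp: J'_def)
  have "card J' < T"
  proof (rule ccontr)
    assume "\<not> card J' < T"
    then obtain K where K: "K \<subseteq> J'" "card K = T" "finite K"
      by (metis obtain_subset_with_card_n not_less)
    obtain h where h: "bij_betw h {..<T} K"
      using ex_bij_betw_nat_finite[OF K(3)] K(2) by (auto simp: lessThan_atLeast0)
    have "sunflower f {..<T} y (x \<circ> h)"
      using sunflower_subset[OF sun, of K] K(1) J'(2) h
      by (intro sunflower_reindex) (auto simp: bij_betw_def)
    moreover have "singular f y ((x \<circ> h) j)" if "j < T" for j
      using bij_betwE[OF h] that K(1) by (auto simp: J'_def)
    ultimately show False using f(2) unfolding degenerate_def by blast
  qed
  moreover have "card (J - J') \<le> sunflower_bound"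
    using J by (intro card_nonsingular_sunflower[OF f(1) sunflower_subset[OF sun] _ _ F])
               (auto simp: J'_def)
  moreover have "card J = card J' + card (J - J')"
    using J J' by (simp add: card_Diff_subset card_mono)
  ultimately show ?thesis by linarith
qed

end

section \<open>Balance of the subdivided star\<close>

text \<open>
  The weights alternate along the path up to a bounded error. Every maximal run of vertices of \<open>U\<close>
  touches one more edge than it has vertices, which pays for the excess \<open>\<gamma>\<close> of each pair of
  neighbours over \<open>2r\<close>.
\<close>

lemma alternating_path_balanced:
  fixes w :: "nat \<Rightarrow> int"
  assumes pair: "\<And>p. w p + w (Suc p) = 2 * r + \<gamma>" and w: "\<And>p. r \<le> w p"
    and k: "\<gamma> * int k \<le> r" and "\<not> U 0" and n: "n \<le> 2 * k + 1"
  shows "(\<Sum>p=1..n. of_bool (U p) * w p) \<le> r * (\<Sum>p<n. of_bool (U p \<or> U (Suc p))) +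
    of_bool (U n) * (\<gamma> * int (n div 2) + of_bool (odd n) * (w n - r))"
proof -
  define g where "g m = \<gamma> * int m" for m
  have \<gamma>: "0 \<le> \<gamma>" using pair[of 0] w[of 0] w[of 1] by simp
  have w_le: "w p \<le> r + \<gamma>" for p using pair[of p] w[of "Suc p"] by simp
  have g_nonneg: "0 \<le> g m" and g_Suc: "g (Suc m) = g m + \<gamma>" for m
    using \<gamma> by (auto simp: g_def distrib_left)
  have g_le: "g m \<le> r" if "m \<le> k" for m
    using mult_left_mono[of "int m" "int k" \<gamma>] that \<gamma> k by (simp add: g_def)
  have "(\<Sum>p=1..n. of_bool (U p) * w p) \<le> r * (\<Sum>p<n. of_bool (U p \<or> U (Suc p))) +
    of_bool (U n) * (g (n div 2) + of_bool (odd n) * (w n - r))"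
    using n
  proof (induction n)
    case 0
    then show ?case using \<open>\<not> U 0\<close> by simp
  next
    case (Suc n)
    show ?case
    proof (cases "even n")
      case True
      then have "Suc n div 2 = n div 2" by auto
      then show ?thesis
        using Suc True g_nonneg[of "n div 2"] g_le[of "n div 2"] by (auto simp: algebra_simps)
    next
      case False
      then have half: "Suc n div 2 = Suc (n div 2)" by auto
      have "Suc (n div 2) \<le> k" using Suc.prems False by presburger
      then show ?thesis
        using Suc False half g_nonneg[of "n div 2"] g_le[of "Suc (n div 2)"] pair[of n] w_le[of n]
          w_le[of "Suc n"]
        by (auto simp: g_Suc algebra_simps)
    qed
  qed
  then show ?thesis by (simp add: g_def)
qed

text \<open>
  A spider is \<open>K\<^bsub>s,1\<^esub>\<close> with every edge subdivided into a path of length \<open>2k + 1\<close>: \<open>(i, p)\<close> is the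
  \<open>p\<close>-th vertex of the \<open>i\<close>-th leg, \<open>(i, 0)\<close> are the roots, and all legs share the centre
  \<open>(0, 2k + 1)\<close>. In \<open>in_M c p\<close>, \<open>c\<close> tells whether the roots lie in \<open>M\<close>; the value tells whether
  position \<open>p\<close> does.
\<close>

locale spider =
  fixes k s a b :: nat
  assumes s: "s \<ge> 1" and a: "a \<ge> 1" and b_le_a: "b \<le> a"
    and ratio: "a * (k * s + 1) \<le> b * ((k + 1) * s)"
begin

definition len :: nat where "len = 2 * k + 1"
definition dM :: nat where "dM = len * s * b"
definition dN :: nat where "dN = len * s * a"
definition r :: nat where "r = k * s * (a + b) + a"

definition node :: "nat \<Rightarrow> nat \<Rightarrow> nat \<times> nat" where
  "node i p = (if p = len then 0 else i, p)"

definition roots :: "(nat \<times> nat) set" where "roots = {..<s} \<times> {0}"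

definition inner :: "(nat \<times> nat) set" where
  "inner = {..<s} \<times> {1..<len} \<union> {(0, len)}"

definition in_M :: "bool \<Rightarrow> nat \<Rightarrow> bool" where "in_M c p \<longleftrightarrow> (even p \<longleftrightarrow> c)"

definition node_dim :: "bool \<Rightarrow> nat \<times> nat \<Rightarrow> nat" where
  "node_dim c u = (if in_M c (snd u) then dM else dN)"

definition spider_edge :: "bool \<Rightarrow> nat \<Rightarrow> nat \<Rightarrow> (nat \<times> nat) \<times> (nat \<times> nat)" where
  "spider_edge c i p =
    (if in_M c p then (node i p, node i (Suc p)) else (node i (Suc p), node i p))"

definition spider_edges :: "bool \<Rightarrow> ((nat \<times> nat) \<times> (nat \<times> nat)) set" where
  "spider_edges c = (\<lambda>(i, p). spider_edge c i p) ` ({..<s} \<times> {..<len})"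

lemma snd_node [simp]: "snd (node i p) = p"
  by (simp add: node_def)

lemma in_M_Suc [simp]: "in_M c (Suc p) \<longleftrightarrow> \<not> in_M c p"
  by (auto simp: in_M_def)

lemma node_in: "i < s \<Longrightarrow> p \<le> len \<Longrightarrow> node i p \<in> roots \<union> inner"
  by (auto simp: node_def roots_def inner_def len_def)

lemma spider_edgesD: "e \<in> spider_edges c \<Longrightarrow> \<exists>i<s. \<exists>p<len. e = spider_edge c i p"
  by (auto simp: spider_edges_def)

lemma inj_spider_edge: "inj_on (\<lambda>(i, p). spider_edge c i p) ({..<s} \<times> {..<len})"
  by (auto simp: inj_on_def spider_edge_def node_def in_M_def split: if_splits)

lemma card_spider_edges: "card (spider_edges c) = s * len"
  by (simp add: spider_edges_def card_image[OF inj_spider_edge] card_cartesian_product)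

lemma r_le_dM: "r \<le> dM"
  using ratio by (simp add: r_def dM_def len_def algebra_simps)

lemma dM_le_dN: "dM \<le> dN"
  using b_le_a by (simp add: dM_def dN_def)

lemma leg_balanced:
  assumes "\<not> U 0"
  shows "(\<Sum>p=1..<len. of_bool (U p) * int (node_dim c (i, p))) + of_bool (U len) * int (len * a) \<le>
    int r * (\<Sum>p<len. of_bool (U p \<or> U (Suc p)))"
proof -
  define \<gamma> where "\<gamma> = int dM + int dN - 2 * int r"
  have \<gamma>: "int r - \<gamma> * int k = int (len * a)"
    by (simp add: \<gamma>_def r_def dM_def dN_def len_def algebra_simps)
  then have k: "\<gamma> * int k \<le> int r" by (metis diff_ge_0_iff_ge of_nat_0_le_iff)
  have interval: "{1..<len} = {1..2 * k}" by (auto simp: len_def)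
  have pair: "int (node_dim c (i, p)) + int (node_dim c (i, Suc p)) = 2 * int r + \<gamma>" for p
    by (simp add: \<gamma>_def node_dim_def in_M_def)
  have w: "int r \<le> int (node_dim c (i, p))" for p
    using r_le_dM dM_le_dN by (simp add: node_dim_def)
  show ?thesis
    using alternating_path_balanced[of "\<lambda>p. int (node_dim c (i, p))" "int r" \<gamma> k U len,
        OF pair w k assms] \<gamma>
    unfolding interval by (auto simp: len_def)
qed

lemma sum_node_dim_inner_subset:
  assumes "S \<subseteq> inner"
  shows "int (sum (node_dim c) S) =
    (\<Sum>i<s. \<Sum>p=1..<len. of_bool (node i p \<in> S) * int (node_dim c (i, p))) +
    of_bool ((0, len) \<in> S) * int (node_dim c (0, len))"
proof -
  let ?leg = "\<lambda>i. {p \<in> {1..<len}. (i, p) \<in> S}"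
  have S: "S = Sigma {..<s} ?leg \<union> (S \<inter> {(0, len)})" using assms by (auto simp: inner_def)
  have "sum (node_dim c) S =
      sum (node_dim c) (Sigma {..<s} ?leg) + sum (node_dim c) (S \<inter> {(0, len)})"
    by (subst S, rule sum.union_disjoint) auto
  also have "sum (node_dim c) (Sigma {..<s} ?leg) = (\<Sum>i<s. \<Sum>p\<in>?leg i. node_dim c (i, p))"
    by (subst sum.Sigma) auto
  also have "\<dots> = (\<Sum>i<s. \<Sum>p=1..<len. if (i, p) \<in> S then node_dim c (i, p) else 0)"
    by (simp only: sum.inter_filter finite_atLeastLessThan)
  also have "\<dots> = (\<Sum>i<s. \<Sum>p=1..<len. of_bool (node i p \<in> S) * node_dim c (i, p))"
    by (intro sum.cong refl) (simp add: node_def)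
  finally show ?thesis by simp
qed

lemma card_touching_spider_edges:
  "int (card {e \<in> spider_edges c. fst e \<in> S \<or> snd e \<in> S}) =
    (\<Sum>i<s. \<Sum>p<len. of_bool (node i p \<in> S \<or> node i (Suc p) \<in> S))"
proof -
  let ?leg = "\<lambda>i. {p \<in> {..<len}. node i p \<in> S \<or> node i (Suc p) \<in> S}"
  have "fst (spider_edge c i p) \<in> S \<or> snd (spider_edge c i p) \<in> S \<longleftrightarrow>
      node i p \<in> S \<or> node i (Suc p) \<in> S" for i p
    by (auto simp: spider_edge_def)
  then have "{e \<in> spider_edges c. fst e \<in> S \<or> snd e \<in> S} =
      (\<lambda>(i, p). spider_edge c i p) ` Sigma {..<s} ?leg"
    unfolding spider_edges_def Compr_image_eq by (intro arg_cong[of _ _ "image _"]) auto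
  moreover have "inj_on (\<lambda>(i, p). spider_edge c i p) (Sigma {..<s} ?leg)"
    by (rule inj_on_subset[OF inj_spider_edge]) auto
  ultimately show ?thesis
    by (simp add: card_image card_SigmaI Int_def del: of_bool_or_iff)
qed

lemma spider_balanced:
  assumes S: "S \<subseteq> inner"
  shows "sum (node_dim c) S \<le> r * card {e \<in> spider_edges c. fst e \<in> S \<or> snd e \<in> S}"
proof -
  let ?w = "\<lambda>i p. of_bool (node i p \<in> S) * int (node_dim c (i, p))"
  let ?t = "\<lambda>i. \<Sum>p<len. of_bool (node i p \<in> S \<or> node i (Suc p) \<in> S) :: int"
  have centre: "node i len = (0, len)" for i by (simp add: node_def)
  have "(0, len) \<in> S \<Longrightarrow> int (node_dim c (0, len)) \<le> int dN"
    using dM_le_dN by (simp add: node_dim_def)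
  then have "int (sum (node_dim c) S) \<le>
      (\<Sum>i<s. \<Sum>p=1..<len. ?w i p) + of_bool ((0, len) \<in> S) * int dN"
    unfolding sum_node_dim_inner_subset[OF S] by simp
  also have "\<dots> = (\<Sum>i<s. (\<Sum>p=1..<len. ?w i p) + of_bool (node i len \<in> S) * int (len * a))"
    by (simp add: centre sum.distrib dN_def mult_ac)
  also have "\<dots> \<le> (\<Sum>i<s. int r * ?t i)"
    using S by (intro sum_mono leg_balanced) (auto simp: node_def inner_def len_def)
  also have "\<dots> = int (r * card {e \<in> spider_edges c. fst e \<in> S \<or> snd e \<in> S})"
    by (simp add: card_touching_spider_edges sum_distrib_left)
  finally show ?thesis by linarith
qed

sublocale template: balanced_template roots inner "spider_edges c" "node_dim c" dM dN r for c
proof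
  show "finite roots" "finite inner" "roots \<inter> inner = {}"
    by (auto simp: roots_def inner_def len_def)
  have "(0, 0) \<in> {..<s} \<times> {..<len}" using s by (simp add: len_def)
  then show "spider_edges c \<noteq> {}" unfolding spider_edges_def by blast
  show "sum (node_dim c) S \<le> r * card {e \<in> spider_edges c. fst e \<in> S \<or> snd e \<in> S}"
    if "S \<subseteq> inner" for S
    using that by (rule spider_balanced)
  show "u \<in> roots \<union> inner \<and> v \<in> roots \<union> inner \<and> node_dim c u = dM \<and> node_dim c v = dN"
    if uv: "(u, v) \<in> spider_edges c" for u v
  proof -
    obtain i p where ip: "i < s" "p < len" "(u, v) = spider_edge c i p"
      using spider_edgesD[OF uv] by blast
    have "node i p \<in> roots \<union> inner" "node i (Suc p) \<in> roots \<union> inner"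
      using ip(1,2) by (intro node_in; simp)+
    then show ?thesis
      using ip(3) by (cases "in_M c p") (auto simp: spider_edge_def node_dim_def)
  qed
qed

end

section \<open>Subdivisions in bipartite graphs\<close>

definition bipartite_of :: "'a set \<Rightarrow> 'a set \<Rightarrow> ('a \<Rightarrow> 'a \<Rightarrow> bool) \<Rightarrow> 'a ugraph" where
  "bipartite_of M N P = (M \<union> N, {{u, v} | u v. u \<in> M \<and> v \<in> N \<and> P u v})"

lemma bipartite_graph_bipartite_of:
  assumes "finite M" "finite N" "M \<inter> N = {}"
  shows "bipartite_graph (bipartite_of M N P) M N"
  unfolding bipartite_graph_def simple_graph_def
proof (intro conjI ballI)
  fix e assume "e \<in> edges (bipartite_of M N P)"
  then obtain u v where e: "e = {u, v}" "u \<in> M" "v \<in> N" by (auto simp: bipartite_of_def)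
  then have "u \<noteq> v" using assms(3) by auto
  with e show "e \<subseteq> verts (bipartite_of M N P)" "card e = 2" "\<exists>u\<in>M. \<exists>v\<in>N. e = {u, v}"
    by (auto simp: bipartite_of_def)
qed (use assms in \<open>auto simp: bipartite_of_def\<close>)

lemma edge_bipartite_of_iff:
  "{x, y} \<in> edges (bipartite_of M N P) \<longleftrightarrow>
    x \<in> M \<and> y \<in> N \<and> P x y \<or> y \<in> M \<and> x \<in> N \<and> P y x"
  by (auto simp: bipartite_of_def doubleton_eq_iff)

lemma card_edges_bipartite_of:
  assumes "M \<inter> N = {}"
  shows "card (edges (bipartite_of M N P)) = card {(u, v). u \<in> M \<and> v \<in> N \<and> P u v}"
proof -
  have "inj_on (\<lambda>(u, v). {u, v}) {(u, v). u \<in> M \<and> v \<in> N \<and> P u v}"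
    using assms by (auto simp: inj_on_def doubleton_eq_iff)
  moreover have "edges (bipartite_of M N P) = (\<lambda>(u, v). {u, v}) ` {(u, v). u \<in> M \<and> v \<in> N \<and> P u v}"
    by (auto simp: bipartite_of_def)
  ultimately show ?thesis by (simp add: card_image)
qed

lemma card_pairs_bij_betw:
  assumes \<mu>: "bij_betw \<mu> M M'" and \<nu>: "bij_betw \<nu> N N'"
  shows "card {(u, v). u \<in> M \<and> v \<in> N \<and> P (\<mu> u) (\<nu> v)} = card {(u, v). u \<in> M' \<and> v \<in> N' \<and> P u v}"
proof (rule bij_betw_same_card)
  show "bij_betw (map_prod \<mu> \<nu>) {(u, v). u \<in> M \<and> v \<in> N \<and> P (\<mu> u) (\<nu> v)}
      {(u, v). u \<in> M' \<and> v \<in> N' \<and> P u v}"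
    using bij_betw_imp_inj_on[OF \<mu>] bij_betw_imp_inj_on[OF \<nu>]
    unfolding bij_betw_imp_surj_on[OF \<mu>, symmetric] bij_betw_imp_surj_on[OF \<nu>, symmetric]
    by (auto simp: bij_betw_def inj_on_def image_iff)
qed

context spider
begin

lemma roots_or_inner_cases:
  assumes "u \<in> roots \<union> inner"
  obtains i p where "i < s" "p \<le> len" "u = node i p"
proof (cases "u = (0, len)")
  case True
  then show ?thesis using s by (intro that[of 0 len]) (auto simp: node_def)
next
  case False
  then show ?thesis
    using assms
    by (intro that[of "fst u" "snd u"]) (auto simp: roots_def inner_def node_def len_def)
qed

lemma two_colouring_unique:
  assumes flip: "\<And>i p. i < s \<Longrightarrow> p < len \<Longrightarrow> Q (node i (Suc p)) \<longleftrightarrow> \<not> Q (node i p)"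
    and u: "u \<in> roots \<union> inner"
  shows "Q u \<longleftrightarrow> in_M (Q (0, 0)) (snd u)"
proof -
  have leg: "Q (node i p) \<longleftrightarrow> in_M (Q (i, 0)) p" if "i < s" "p \<le> len" for i p
    using that(2)
  proof (induction p)
    case 0
    then show ?case by (simp add: node_def in_M_def len_def)
  next
    case (Suc p)
    then show ?case using flip[OF that(1), of p] by simp
  qed
  obtain i p where "i < s" "p \<le> len" "u = node i p" using roots_or_inner_cases[OF u] .
  moreover have "Q (i, 0) \<longleftrightarrow> Q (0, 0)"
    using leg[OF \<open>i < s\<close>, of len] leg[of 0 len] \<open>i < s\<close> by (auto simp: node_def in_M_def)
  ultimately show ?thesis using leg[of i p] by simp
qed

definition spider_vertex :: "nat \<Rightarrow> nat \<times> nat \<Rightarrow> nat subdiv_vertex" where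
  "spider_vertex j u = subdiv_point len (fst u) (s + j) (snd u)"

lemma spider_vertex_node:
  "spider_vertex j (node i p) = subdiv_point len i (s + j) p"
  by (simp add: spider_vertex_def node_def subdiv_point_def len_def)

lemma spider_vertex_root: "u \<in> roots \<Longrightarrow> spider_vertex j u = spider_vertex 0 u"
  by (auto simp: spider_vertex_def roots_def subdiv_point_def)

lemma complete_bipartite_edge:
  assumes "i < s" "j < t"
  shows "{i, s + j} \<in> edges (complete_bipartite s t)"
proof -
  have "i < s \<and> s \<le> s + j \<and> s + j < s + t" using assms by simp
  then show ?thesis unfolding complete_bipartite_def snd_conv by blast
qed

lemma spider_vertex_in_subdivision:
  assumes "j < t" "u \<in> roots \<union> inner"
  shows "spider_vertex j u \<in> verts (subdivision len (complete_bipartite s t))"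
proof -
  obtain i p where ip: "i < s" "p \<le> len" "u = node i p" using roots_or_inner_cases[OF assms(2)] .
  then show ?thesis
    using complete_bipartite_edge[OF ip(1) assms(1)] assms(1)
    by (auto simp: spider_vertex_node subdiv_point_def subdivision_def complete_bipartite_def)
qed

lemma spider_vertex_edge:
  assumes "j < t" "i < s" "p < len"
  shows "{spider_vertex j (node i p), spider_vertex j (node i (Suc p))}
    \<in> edges (subdivision len (complete_bipartite s t))"
proof -
  have "i < s + j" using assms(2) by simp
  then show ?thesis
    using complete_bipartite_edge[OF assms(2,1)] assms(3)
    unfolding spider_vertex_node subdivision_def snd_conv by blast
qed

lemma spider_vertex_inj:
  assumes "u \<in> roots \<union> inner" "u' \<in> roots \<union> inner" "spider_vertex j u = spider_vertex j' u'"
  shows "u = u' \<and> (j = j' \<or> u \<in> roots)"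
  using assms
  by (auto simp: spider_vertex_def subdiv_point_def roots_def inner_def len_def split: if_splits)

definition spider_family :: "'a ugraph \<Rightarrow> nat \<Rightarrow> (nat \<Rightarrow> nat \<times> nat \<Rightarrow> 'a) \<Rightarrow> bool" where
  "spider_family G t \<psi> \<longleftrightarrow>
    (\<forall>j<t. \<forall>u\<in>roots \<union> inner. \<psi> j u \<in> verts G) \<and>
    (\<forall>j<t. \<forall>i<s. \<forall>p<len. {\<psi> j (node i p), \<psi> j (node i (Suc p))} \<in> edges G) \<and>
    (\<forall>j<t. \<forall>u\<in>roots. \<psi> j u = \<psi> 0 u) \<and>
    (\<forall>j<t. \<forall>j'<t. \<forall>u\<in>roots \<union> inner. \<forall>u'\<in>roots \<union> inner.
      \<psi> j u = \<psi> j' u' \<longrightarrow> u = u' \<and> (j = j' \<or> u \<in> roots))"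

lemma spider_familyD:
  assumes "spider_family G t \<psi>" "j < t"
  shows "u \<in> roots \<union> inner \<Longrightarrow> \<psi> j u \<in> verts G"
    and "i < s \<Longrightarrow> p < len \<Longrightarrow> {\<psi> j (node i p), \<psi> j (node i (Suc p))} \<in> edges G"
    and "u \<in> roots \<Longrightarrow> \<psi> j u = \<psi> 0 u"
    and "j' < t \<Longrightarrow> u \<in> roots \<union> inner \<Longrightarrow> u' \<in> roots \<union> inner \<Longrightarrow> \<psi> j u = \<psi> j' u' \<Longrightarrow>
      u = u' \<and> (j = j' \<or> u \<in> roots)"
  using assms unfolding spider_family_def by blast+

lemma copy_imp_spider_family:
  assumes "contains_copy G (subdivision len (complete_bipartite s t))"
  obtains \<psi> where "spider_family G t \<psi>"
proof -
  let ?H = "subdivision len (complete_bipartite s t)"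
  obtain \<phi> where \<phi>: "inj_on \<phi> (verts ?H)" "\<phi> ` verts ?H \<subseteq> verts G"
    "\<And>e. e \<in> edges ?H \<Longrightarrow> \<phi> ` e \<in> edges G"
    using assms by (auto simp: contains_copy_def)
  define \<psi> where "\<psi> j u = \<phi> (spider_vertex j u)" for j u
  have "spider_family G t \<psi>"
    unfolding spider_family_def
  proof (intro conjI allI ballI impI)
    show "\<psi> j u \<in> verts G" if "j < t" "u \<in> roots \<union> inner" for j u
      using \<phi>(2) spider_vertex_in_subdivision[OF that] by (auto simp: \<psi>_def)
    show "{\<psi> j (node i p), \<psi> j (node i (Suc p))} \<in> edges G" if "j < t" "i < s" "p < len" for j i p
      using \<phi>(3)[OF spider_vertex_edge[OF that]] by (simp add: \<psi>_def)
    show "\<psi> j u = \<psi> 0 u" if "u \<in> roots" for j u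
      using spider_vertex_root[OF that, of j] by (simp add: \<psi>_def)
    fix j j' u u'
    assume that: "j < t" "j' < t" "u \<in> roots \<union> inner" "u' \<in> roots \<union> inner" "\<psi> j u = \<psi> j' u'"
    have "spider_vertex j u = spider_vertex j' u'"
      using that(5) unfolding \<psi>_def
      by (rule inj_onD[OF \<phi>(1)]) (use spider_vertex_in_subdivision that in blast)+
    from spider_vertex_inj[OF that(3,4) this] show "u = u'" "j = j' \<or> u \<in> roots" by blast+
  qed
  then show ?thesis by (rule that)
qed

lemma spider_family_bipartite:
  assumes family: "spider_family (bipartite_of M N P) t \<psi>" and disjoint: "M \<inter> N = {}"
  obtains c where
    "\<And>j u. j < t \<Longrightarrow> u \<in> roots \<union> inner \<Longrightarrow> \<psi> j u \<in> (if in_M c (snd u) then M else N)"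
    "\<And>j u v. j < t \<Longrightarrow> (u, v) \<in> spider_edges c \<Longrightarrow> P (\<psi> j u) (\<psi> j v)"
proof
  let ?c = "\<psi> 0 (0, 0) \<in> M"
  note edge = spider_familyD(2)[OF family]
  have colour: "\<psi> j u \<in> M \<longleftrightarrow> in_M ?c (snd u)" if "j < t" "u \<in> roots \<union> inner" for j u
  proof -
    have "\<psi> j (0, 0) = \<psi> 0 (0, 0)"
      using s by (intro spider_familyD(3)[OF family that(1)]) (simp add: roots_def)
    moreover have "\<psi> j u \<in> M \<longleftrightarrow> in_M (\<psi> j (0, 0) \<in> M) (snd u)"
    proof (rule two_colouring_unique[OF _ that(2)])
      show "\<psi> j (node i (Suc p)) \<in> M \<longleftrightarrow> \<psi> j (node i p) \<notin> M" if "i < s" "p < len" for i p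
        using edge[OF \<open>j < t\<close> that] disjoint by (auto simp: edge_bipartite_of_iff)
    qed
    ultimately show ?thesis by simp
  qed
  show "\<psi> j u \<in> (if in_M ?c (snd u) then M else N)" if "j < t" "u \<in> roots \<union> inner" for j u
  proof -
    have "\<psi> j u \<in> M \<union> N" using spider_familyD(1)[OF family that] by (simp add: bipartite_of_def)
    then show ?thesis using colour[OF that] by auto
  qed
  show "P (\<psi> j u) (\<psi> j v)" if "j < t" and uv: "(u, v) \<in> spider_edges ?c" for j u v
  proof -
    obtain i p where ip: "i < s" "p < len" "(u, v) = spider_edge ?c i p"
      using spider_edgesD[OF uv] by blast
    have "node i p \<in> roots \<union> inner" "node i (Suc p) \<in> roots \<union> inner"
      using ip(1,2) by (intro node_in; simp)+
    then show ?thesis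
      using edge[OF that(1) ip(1,2)] colour[OF that(1)] ip(3)
      by (cases "in_M ?c p") (simp_all add: edge_bipartite_of_iff spider_edge_def)
  qed
qed

lemma spider_edge_ends:
  assumes "(u, v) \<in> spider_edges c"
  shows "in_M c (snd u)" "\<not> in_M c (snd v)"
proof -
  obtain i p where "(u, v) = spider_edge c i p" using spider_edgesD[OF assms] by blast
  then show "in_M c (snd u)" "\<not> in_M c (snd v)"
    by (cases "in_M c p"; simp add: spider_edge_def)+
qed

lemma spider_edge_not_both_roots:
  assumes "(u, v) \<in> spider_edges c"
  shows "u \<notin> roots \<or> v \<notin> roots"
proof -
  obtain i p where "(u, v) = spider_edge c i p" using spider_edgesD[OF assms] by blast
  then have "snd u = Suc p \<or> snd v = Suc p" by (cases "in_M c p") (simp_all add: spider_edge_def)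
  then show ?thesis by (auto simp: roots_def)
qed

section \<open>The random bipartite graph\<close>

text \<open>
  Every singular petal gains a factor \<open>O(1/q)\<close>: \<open>s * dN\<close> petals pay for the choice of the roots, \<open>r\<close>
  for the edge density, and one more makes the failure probability small.
\<close>

definition num_petals :: nat where "num_petals = s * dN + r + 1"

definition degree_bound :: nat where "degree_bound = 2 * (num_petals * (s * len)) + 2"

definition num_unknowns :: "bool \<Rightarrow> nat" where "num_unknowns c = card (template.coords c inner)"

definition zeros_const :: "bool \<Rightarrow> nat" where
  "zeros_const c = ((num_unknowns c + 1) * degree_bound) ^ num_unknowns c"

definition sunflower_const :: "bool \<Rightarrow> nat" where
  "sunflower_const c = (2 ^ r) ^ (s * len) * (2 ^ (s * len * r) * zeros_const c ^ num_unknowns c)"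

definition union_const :: "bool \<Rightarrow> nat" where
  "union_const c =
    (2 ^ r) ^ (num_petals * (s * len)) * (2 ^ card inner * num_unknowns c) ^ num_petals"

lemma card_coords_roots_le: "card (template.coords c roots) \<le> s * dN"
proof -
  have "card (template.coords c roots) = sum (node_dim c) roots"
    by (rule template.card_coords[OF template.finite_R])
  also have "\<dots> \<le> (\<Sum>u\<in>roots. dN)"
    using dM_le_dN by (intro sum_mono) (simp add: node_dim_def)
  finally show ?thesis by (simp add: roots_def card_cartesian_product)
qed

end

locale spider_construction = finite_subfield F + spider k s a b
  for F :: "'k::field set" and k s a b :: nat +
  fixes Z :: "(nat \<Rightarrow> 'k) set"
  assumes Z: "Z \<subseteq> PiE {..<r} (\<lambda>_. F)" and card_Z: "card Z = 2 ^ r"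
begin

sublocale random_polys F dM dN r degree_bound Z
  by unfold_locales (auto simp: degree_bound_def Z)

sublocale construction:
  template_construction F dM dN r degree_bound Z roots inner "spider_edges c" "node_dim c" num_petals
  for c
  by unfold_locales (simp add: degree_bound_def card_spider_edges)

lemma card_degenerate_mult_le:
  "real (card {f \<in> polys. construction.degenerate c f}) * real (card F) ^ (r + 1) \<le>
    card polys * real (union_const c)"
proof -
  have F_gt_0: "real (card F) > 0" using card_F_gt_1 by simp
  have "real (card F) ^ card (template.coords c roots) * real (card F) ^ (r + 1) \<le>
      real (card F) ^ (s * dN) * real (card F) ^ (r + 1)"
    using card_coords_roots_le[of c] card_F_gt_1
    by (intro mult_right_mono power_increasing) auto
  also have "\<dots> = real (card F) ^ num_petals" by (simp add: num_petals_def power_add)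
  finally have "real (card F) ^ card (template.coords c roots) * real (card F) ^ (r + 1) /
      real (card F) ^ num_petals \<le> 1"
    using F_gt_0 by (simp add: divide_le_eq_1)
  then have "card polys * real (union_const c) *
      (real (card F) ^ card (template.coords c roots) * real (card F) ^ (r + 1) /
        real (card F) ^ num_petals) \<le> card polys * real (union_const c) * 1"
    by (intro mult_left_mono) auto
  then show ?thesis
    using mult_right_mono[OF construction.card_degenerate[of c], of "real (card F) ^ (r + 1)"]
    by (simp add: union_const_def num_unknowns_def card_Z card_spider_edges power_divide mult_ac)
qed

lemma spider_family_imp_sunflower:
  assumes f: "f \<in> polys"
    and family: "spider_family (bipartite_of M N (\<lambda>u v. hits f (case_sum (\<mu> u) (\<nu> v)))) t \<psi>"
    and "0 < t" and disjoint: "M \<inter> N = {}"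
    and \<mu>: "inj_on \<mu> M" "\<mu> ` M \<subseteq> PiE {..<dM} (\<lambda>_. F)"
    and \<nu>: "inj_on \<nu> N" "\<nu> ` N \<subseteq> PiE {..<dN} (\<lambda>_. F)"
  obtains c y x where "construction.sunflower c f {..<t} y x"
proof -
  obtain c where
    side: "\<And>j u. j < t \<Longrightarrow> u \<in> roots \<union> inner \<Longrightarrow> \<psi> j u \<in> (if in_M c (snd u) then M else N)"
    and hit: "\<And>j u v. j < t \<Longrightarrow> (u, v) \<in> spider_edges c \<Longrightarrow> hits f (case_sum (\<mu> (\<psi> j u)) (\<nu> (\<psi> j v)))"
    by (rule spider_family_bipartite[OF family disjoint]) (rule that)
  define P where "P j u = (if in_M c (snd u) then \<mu> (\<psi> j u) else \<nu> (\<psi> j u))" for j u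
  have P_inj: "u = u' \<and> (j = j' \<or> u \<in> roots)"
    if "j < t" "j' < t" "u \<in> roots \<union> inner" "u' \<in> roots \<union> inner"
      "in_M c (snd u) \<longleftrightarrow> in_M c (snd u')" "P j u = P j' u'" for j u j' u'
  proof -
    have "\<psi> j u = \<psi> j' u'"
      using side[OF that(1,3)] side[OF that(2,4)] that(5,6) \<mu>(1) \<nu>(1)
      by (auto simp: P_def dest: inj_onD split: if_splits)
    then show ?thesis by (rule spider_familyD(4)[OF family that(1-4)])
  qed
  have "construction.sunflower c f {..<t}
      (\<lambda>(u, i)\<in>template.coords c roots. P 0 u i) (\<lambda>j. \<lambda>(u, i)\<in>template.coords c inner. P j u i)"
  proof (rule construction.sunflowerI[OF f])
    show "0 \<in> {..<t}" using \<open>0 < t\<close> by simp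
    show "P j u \<in> PiE {..<node_dim c u} (\<lambda>_. F)" if "j \<in> {..<t}" "u \<in> roots \<union> inner" for j u
      using side[of j u] that \<mu>(2) \<nu>(2) by (auto simp: P_def node_dim_def split: if_splits)
    show "P j u = P 0 u" if "j \<in> {..<t}" "u \<in> roots" for j u
      using spider_familyD(3)[OF family, of j u] that by (simp add: P_def)
    show "hits f (case_sum (P j u) (P j v))" if "j \<in> {..<t}" "(u, v) \<in> spider_edges c" for j u v
      using hit[of j u v] spider_edge_ends[OF that(2)] that by (simp add: P_def)
    show "j = j' \<and> u = u' \<and> v = v'" if "j \<in> {..<t}" "j' \<in> {..<t}" "(u, v) \<in> spider_edges c"
      "(u', v') \<in> spider_edges c" "P j u = P j' u'" "P j v = P j' v'" for j u v j' u' v'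
      using P_inj[of j j' u u'] P_inj[of j j' v v']
        template.edge[OF that(3)] spider_edge_ends[OF that(3)] spider_edge_not_both_roots[OF that(3)]
        template.edge[OF that(4)] spider_edge_ends[OF that(4)] that
      by auto
  qed
  then show ?thesis by (rule that)
qed

lemma graph_free_random:
  assumes f: "f \<in> polys" "\<And>c. \<not> construction.degenerate c f" and disjoint: "M \<inter> N = {}"
    and \<mu>: "inj_on \<mu> M" "\<mu> ` M \<subseteq> PiE {..<dM} (\<lambda>_. F)"
    and \<nu>: "inj_on \<nu> N" "\<nu> ` N \<subseteq> PiE {..<dN} (\<lambda>_. F)"
    and F: "\<And>c. zeros_const c < card F" and t: "\<And>c. num_petals + sunflower_const c \<le> t"
  shows "graph_free (bipartite_of M N (\<lambda>u v. hits f (case_sum (\<mu> u) (\<nu> v))))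
    (subdivision len (complete_bipartite s t))"
  unfolding graph_free_def
proof
  assume "contains_copy (bipartite_of M N (\<lambda>u v. hits f (case_sum (\<mu> u) (\<nu> v))))
    (subdivision len (complete_bipartite s t))"
  then obtain \<psi> where
    family: "spider_family (bipartite_of M N (\<lambda>u v. hits f (case_sum (\<mu> u) (\<nu> v)))) t \<psi>"
    by (rule copy_imp_spider_family)
  have "0 < t" using t[of True] by (simp add: num_petals_def)
  obtain c y x where "construction.sunflower c f {..<t} y x"
    using spider_family_imp_sunflower[OF f(1) family \<open>0 < t\<close> disjoint \<mu> \<nu>] .
  then have "card {..<t} < num_petals + construction.sunflower_bound c"
    using F[of c]
    by (intro construction.card_sunflower[OF f]) (auto simp: zeros_const_def num_unknowns_def)
  moreover have "construction.sunflower_bound c = sunflower_const c"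
    by (simp add: construction.sunflower_bound_def construction.nonsingular_bound_def
        sunflower_const_def zeros_const_def num_unknowns_def card_Z card_spider_edges)
  ultimately show False using t[of c] by simp
qed

lemma exists_dense_nondegenerate:
  assumes PM: "PM \<subseteq> PiE {..<dM} (\<lambda>_. F)" "PM \<noteq> {}" and PN: "PN \<subseteq> PiE {..<dN} (\<lambda>_. F)" "PN \<noteq> {}"
    and F: "2 * (union_const True + union_const False) < card F"
  obtains f where "f \<in> polys" "\<And>c. \<not> construction.degenerate c f"
    "1 / 2 * (real (card PM) * real (card PN) * (2 / real (card F)) ^ r) \<le>
      real (card {(x, y). x \<in> PM \<and> y \<in> PN \<and> hits f (case_sum x y)})"
proof -
  define B where "B c = {f \<in> polys. construction.degenerate c f}" for c
  have fin: "finite (B c)" for c by (simp add: B_def)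
  have F_gt_0: "real (card F) > 0" using card_F_gt_1 by simp
  have "real (2 * card (B True \<union> B False) * card F ^ r) * card F =
      2 * (real (card (B True \<union> B False)) * real (card F) ^ (r + 1))" by simp
  also have "\<dots> \<le> 2 * ((real (card (B True)) + real (card (B False))) * real (card F) ^ (r + 1))"
    using card_Un_le[of "B True" "B False"] by (intro mult_left_mono mult_right_mono) auto
  also have "\<dots> \<le> card polys * real (2 * (union_const True + union_const False))"
    using card_degenerate_mult_le[of True] card_degenerate_mult_le[of False]
    by (simp add: B_def algebra_simps)
  also have "\<dots> < card polys * real (card F)"
    using F card_polys_gt_0 by (intro mult_strict_left_mono) auto
  finally have "real (2 * card (B True \<union> B False) * card F ^ r) < real (card polys)"
    using F_gt_0 by simp
  also have "\<dots> \<le> real (card Z * card polys)"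
    using mult_right_mono[of 1 "2 ^ r" "real (card polys)"] by (simp add: card_Z)
  finally have "2 * card (B True \<union> B False) * card F ^ r < card Z * card polys"
    by (simp only: of_nat_less_iff)
  moreover have "B True \<union> B False \<subseteq> polys" by (auto simp: B_def)
  ultimately obtain f where f: "f \<in> polys - (B True \<union> B False)"
    and "1 / 2 * (real (card PM) * real (card PN) * (real (card Z) / real (card F) ^ r)) \<le>
      real (card {q \<in> PM \<times> PN. hits f (case_prod case_sum q)})"
    using exists_dense_outside[OF PM PN] by blast
  moreover have "{q \<in> PM \<times> PN. hits f (case_prod case_sum q)} =
      {(x, y). x \<in> PM \<and> y \<in> PN \<and> hits f (case_sum x y)}" by auto
  moreover have "\<not> construction.degenerate c f" for c using f by (cases c) (auto simp: B_def)
  ultimately show ?thesis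
    using that[of f] f by (simp add: card_Z power_divide)
qed

end

context spider
begin

definition dense_free_graph_exists :: "nat \<Rightarrow> nat \<Rightarrow> bool" where
  "dense_free_graph_exists t q \<longleftrightarrow> (\<exists>(G :: nat ugraph) M N.
    bipartite_graph G M N \<and> card M = q ^ dM \<and> card N = q ^ dN \<and>
    graph_free G (subdivision len (complete_bipartite s t)) \<and>
    1 / 2 * (real q ^ dM * real q ^ dN / real q ^ r) \<le> card (edges G))"

lemma exists_dense_free_graph_over_field:
  fixes F :: "'k::field set"
  assumes "finite_subfield F" and q: "0 < q" "q \<le> card F" "card F \<le> 2 * q"
    and F: "2 * (union_const True + union_const False) < card F" "\<And>c. zeros_const c < card F"
    and t: "\<And>c. num_petals + sunflower_const c \<le> t"
  shows "dense_free_graph_exists t q"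
proof -
  interpret finite_subfield F by fact
  have points: "\<exists>A. A \<subseteq> PiE {..<n} (\<lambda>_. F) \<and> card A = m" if "m \<le> card F ^ n" for m n
    using that obtain_subset_with_card_n[of m "PiE {..<n} (\<lambda>_. F)"] by (auto simp: card_PiE)
  obtain Z where Z: "Z \<subseteq> PiE {..<r} (\<lambda>_. F)" "card Z = 2 ^ r"
    using points[of "2 ^ r" r] power_mono[of 2 "card F" r] card_F_gt_1 by auto
  interpret spider_construction F k s a b Z using Z by unfold_locales
  define M where "M = {..<q ^ dM}"
  define N where "N = {q ^ dM..<q ^ dM + q ^ dN}"
  have MN: "finite M" "finite N" "card M = q ^ dM" "card N = q ^ dN" "M \<inter> N = {}"
    "M \<noteq> {}" "N \<noteq> {}"
    using q(1) by (auto simp: M_def N_def lessThan_empty_iff)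
  have "card M \<le> card (PiE {..<dM} (\<lambda>_. F))" "card N \<le> card (PiE {..<dN} (\<lambda>_. F))"
    using power_mono[OF q(2)] by (simp_all add: MN card_PiE)
  then obtain \<mu> \<nu> where \<mu>: "inj_on \<mu> M" "\<mu> ` M \<subseteq> PiE {..<dM} (\<lambda>_. F)"
    and \<nu>: "inj_on \<nu> N" "\<nu> ` N \<subseteq> PiE {..<dN} (\<lambda>_. F)"
    using MN(1,2) by (metis card_le_inj finite_PiE finite_F finite_lessThan)
  obtain f where f: "f \<in> polys" "\<And>c. \<not> construction.degenerate c f"
    and dense: "1 / 2 * (real (card (\<mu> ` M)) * real (card (\<nu> ` N)) * (2 / real (card F)) ^ r) \<le>
      real (card {(x, y). x \<in> \<mu> ` M \<and> y \<in> \<nu> ` N \<and> hits f (case_sum x y)})"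
    using exists_dense_nondegenerate[OF \<mu>(2) _ \<nu>(2) _ F(1)] MN(6,7) by blast
  let ?G = "bipartite_of M N (\<lambda>u v. hits f (case_sum (\<mu> u) (\<nu> v)))"
  have "(1 / real q) ^ r \<le> (2 / real (card F)) ^ r"
    using q by (intro power_mono) (simp_all add: field_simps flip: of_nat_mult)
  then have "real q ^ dM * real q ^ dN * (1 / real q) ^ r \<le>
      real q ^ dM * real q ^ dN * (2 / real (card F)) ^ r"
    by (rule mult_left_mono) simp
  also have "1 / 2 * \<dots> \<le> card {(x, y). x \<in> \<mu> ` M \<and> y \<in> \<nu> ` N \<and> hits f (case_sum x y)}"
    using dense by (simp add: card_image[OF \<mu>(1)] card_image[OF \<nu>(1)] MN(3,4))
  also have "\<dots> = card (edges ?G)"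
    using card_pairs_bij_betw[OF inj_on_imp_bij_betw[OF \<mu>(1)] inj_on_imp_bij_betw[OF \<nu>(1)],
        of "\<lambda>x y. hits f (case_sum x y)"]
    by (simp add: card_edges_bipartite_of[OF MN(5)])
  finally have "1 / 2 * (real q ^ dM * real q ^ dN / real q ^ r) \<le> card (edges ?G)"
    by (simp add: power_one_over)
  then show ?thesis
    unfolding dense_free_graph_exists_def
    using MN(3,4) graph_free_random[OF f MN(5) \<mu> \<nu> F(2) t]
    by (intro exI[of _ ?G] exI[of _ M] exI[of _ N])
       (simp add: bipartite_graph_bipartite_of[OF MN(1,2,5)])
qed

end

section \<open>Fields of prime power order\<close>

lemma card_roots_separable:
  fixes p :: "'a::alg_closed_field poly"
  assumes "p \<noteq> 0" "\<And>x. poly p x = 0 \<Longrightarrow> poly (pderiv p) x \<noteq> 0"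
  shows "card {x. poly p x = 0} = degree p"
  using assms
proof (induction "degree p" arbitrary: p rule: less_induct)
  case less
  show ?case
  proof (cases "degree p = 0")
    case True
    then obtain c where "p = [:c:]" using degree_eq_zeroE by blast
    then show ?thesis using less.prems(1) by simp
  next
    case False
    then obtain x where "poly p x = 0" using alg_closed_imp_poly_has_root by blast
    then obtain q where p: "p = [:- x, 1:] * q" by (auto simp: poly_eq_0_iff_dvd elim: dvdE)
    have pderiv: "poly (pderiv p) y = poly q y + (y - x) * poly (pderiv q) y" for y
      unfolding p pderiv_mult by (simp add: pderiv_pCons algebra_simps)
    have q: "q \<noteq> 0" "degree p = Suc (degree q)"
      using less.prems(1) p by (auto simp: degree_mult_eq simp del: mult_pCons_left)
    have "poly q x \<noteq> 0" using less.prems(2)[of x] pderiv[of x] by (simp add: p)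
    moreover have "card {y. poly q y = 0} = degree q"
    proof (rule less.hyps)
      show "poly (pderiv q) y \<noteq> 0" if "poly q y = 0" for y
        using less.prems(2)[of y] pderiv[of y] that by (auto simp: p)
    qed (use q in auto)
    moreover have "{y. poly p y = 0} = insert x {y. poly q y = 0}" by (auto simp: p)
    moreover have "finite {y. poly q y = 0}" using q(1) by (rule poly_roots_finite)
    ultimately show ?thesis using q(2) by simp
  qed
qed

lemma card_frobenius_fixed_points:
  fixes e :: nat
  assumes "prime CHAR('a::alg_closed_field)" "e > 0"
  shows "card {x :: 'a. x ^ (CHAR('a) ^ e) = x} = CHAR('a) ^ e"
proof -
  define q where "q = CHAR('a) ^ e"
  have q: "q > 1" unfolding q_def by (rule one_less_power[OF prime_gt_1_nat[OF assms(1)] assms(2)])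
  define p :: "'a poly" where "p = monom 1 q + monom (- 1) 1"
  have degree: "degree p = q"
    unfolding p_def using q by (subst degree_add_eq_left) (auto simp: degree_monom_eq)
  have "of_nat q = (0 :: 'a)" using assms(2) by (simp add: of_nat_eq_0_iff_char_dvd q_def)
  then have pderiv: "pderiv p = [:- 1:]" by (simp add: p_def pderiv_add pderiv_monom monom_0)
  have "p \<noteq> 0" using degree q by auto
  then have "card {x. poly p x = 0} = degree p"
    using pderiv by (intro card_roots_separable) simp_all
  moreover have "{x. poly p x = 0} = {x. x ^ q = x}" by (simp add: p_def poly_monom)
  ultimately show ?thesis by (simp add: degree q_def)
qed

lemma infinite_alg_closed_prime_char:
  assumes "prime CHAR('a::alg_closed_field)"
  shows "infinite (UNIV :: 'a set)"
proof
  assume fin: "finite (UNIV :: 'a set)"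
  define n where "n = card (UNIV :: 'a set)"
  have "n < 2 ^ Suc n" using less_exp[of "Suc n"] by linarith
  also have "\<dots> \<le> CHAR('a) ^ Suc n" using prime_ge_2_nat[OF assms] by (rule power_mono) simp
  also have "\<dots> = card {x :: 'a. x ^ (CHAR('a) ^ Suc n) = x}"
    by (rule card_frobenius_fixed_points[OF assms, symmetric]) simp
  also have "\<dots> \<le> n" unfolding n_def by (intro card_mono fin) auto
  finally show False by simp
qed

lemma finite_subfield_frobenius_fixed_points:
  assumes prime: "prime CHAR('a::alg_closed_field)" and e: "e > 0"
  shows "finite_subfield {x :: 'a. x ^ (CHAR('a) ^ e) = x}"
proof
  define q where "q = CHAR('a) ^ e"
  have q: "q > 0" using prime_gt_0_nat[OF prime] by (simp add: q_def)
  have add: "(x + y) ^ q = x ^ q + y ^ q" for x y :: 'a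
    using freshmans_dream'[OF prime] by (simp add: q_def)
  have minus: "(- x) ^ q = - (x ^ q)" for x :: 'a
    using add[of x "- x"] q by (simp add: eq_neg_iff_add_eq_0 add.commute power_0_left)
  show "infinite (UNIV :: 'a set)" by (rule infinite_alg_closed_prime_char[OF prime])
  show "finite {x :: 'a. x ^ (CHAR('a) ^ e) = x}"
    using prime_gt_0_nat[OF prime]
    by (intro card_ge_0_finite) (simp add: card_frobenius_fixed_points[OF prime e])
  show "x + y \<in> {x. x ^ (CHAR('a) ^ e) = x}"
    if "x \<in> {x. x ^ (CHAR('a) ^ e) = x}" "y \<in> {x. x ^ (CHAR('a) ^ e) = x}" for x y :: 'a
    using that add by (simp add: q_def)
  show "- x \<in> {x. x ^ (CHAR('a) ^ e) = x}" if "x \<in> {x. x ^ (CHAR('a) ^ e) = x}" for x :: 'a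
    using that minus by (simp add: q_def)
qed (use prime_gt_0_nat[OF prime] in \<open>auto simp: power_mult_distrib power_inverse power_0_left\<close>)

lemma CHAR_bit: "CHAR(bit) = 2"
proof (rule CHAR_eqI)
  have "(of_nat n :: bit) = of_bool (odd n)" for n
    by (induction n) auto
  then show "2 dvd n" if "of_nat n = (0 :: bit)" for n
    using that by (auto split: if_splits)
qed auto

lemma exists_finite_subfield_between:
  fixes q :: nat
  assumes "q \<ge> 2"
  obtains F :: "bit alg_closure set" where "finite_subfield F" "q \<le> card F" "card F \<le> 2 * q"
proof -
  have char: "CHAR(bit alg_closure) = 2" by (simp add: CHAR_bit)
  then have prime: "prime CHAR(bit alg_closure)" by simp
  obtain n where n: "2 ^ n < q" "q \<le> 2 ^ (n + 1)"
    using ex_power_ivl2[of 2 q] assms by auto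
  define F where "F = {x :: bit alg_closure. x ^ (CHAR(bit alg_closure) ^ (n + 1)) = x}"
  have "finite_subfield F"
    unfolding F_def by (rule finite_subfield_frobenius_fixed_points[OF prime]) simp
  moreover have "card F = 2 ^ (n + 1)"
    using card_frobenius_fixed_points[OF prime, of "n + 1"] by (simp only: F_def char)
  ultimately show ?thesis using n by (intro that[of F]) auto
qed

section \<open>The main theorem\<close>

context spider
begin

lemma eventually_dense_free_graph_exists:
  obtains t0 q0 where "\<And>t q. t \<ge> t0 \<Longrightarrow> q \<ge> q0 \<Longrightarrow> dense_free_graph_exists t q"
proof
  fix t q :: nat
  assume t: "t \<ge> num_petals + sunflower_const True + sunflower_const False"
    and q: "q \<ge> 2 * (union_const True + union_const False) +
      zeros_const True + zeros_const False + 2"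
  obtain F :: "bit alg_closure set" where F: "finite_subfield F" "q \<le> card F" "card F \<le> 2 * q"
    using exists_finite_subfield_between[of q] q by auto
  show "dense_free_graph_exists t q"
  proof (rule exists_dense_free_graph_over_field[OF F(1) _ F(2,3)])
    show "zeros_const c < card F" for c using q F(2) by (cases c) auto
    show "num_petals + sunflower_const c \<le> t" for c using t by (cases c) auto
  qed (use q F(2) in auto)
qed

lemma edge_exponent:
  "real dM * (1 - real k / (2 * real k + 1)) +
    real dN * (1 - real k / (2 * real k + 1) - 1 / ((2 * real k + 1) * real s)) =
    real dM + real dN - real r"
proof -
  have "2 * real k + 1 \<noteq> 0" "real s \<noteq> 0" using s by (auto simp: add_nonneg_eq_0_iff)
  then have "real dM * (real k / (2 * real k + 1)) = real s * real b * real k"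
    "real dN * (real k / (2 * real k + 1)) = real s * real a * real k"
    "real dN * (1 / ((2 * real k + 1) * real s)) = real a"
    by (simp_all add: dM_def dN_def len_def divide_simps) (simp_all add: algebra_simps)
  then show ?thesis unfolding right_diff_distrib by (simp add: r_def algebra_simps)
qed

lemma powr_edge_exponent:
  fixes q :: nat
  assumes "0 < q"
  shows "real (q ^ dM) powr (1 - real k / (2 * real k + 1)) *
    real (q ^ dN) powr (1 - real k / (2 * real k + 1) - 1 / ((2 * real k + 1) * real s)) =
    real q ^ dM * real q ^ dN / real q ^ r"
proof -
  have "real (q ^ n) powr x = real q powr (real n * x)" for n x
    using assms by (simp add: powr_powr flip: powr_realpow)
  then have "real (q ^ dM) powr (1 - real k / (2 * real k + 1)) *
      real (q ^ dN) powr (1 - real k / (2 * real k + 1) - 1 / ((2 * real k + 1) * real s)) =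
      real q powr (real dM + real dN - real r)"
    by (simp only: edge_exponent flip: powr_add)
  then show ?thesis using assms by (simp add: powr_diff powr_add powr_realpow)
qed

lemma dense_free_graph_exists_powr:
  assumes "dense_free_graph_exists t q" "0 < q"
  shows "\<exists>(G :: nat ugraph) M N.
    bipartite_graph G M N \<and> real (card M) = real q powr real dM \<and> card N = q ^ dN \<and>
    graph_free G (subdivision (2 * k + 1) (complete_bipartite s t)) \<and>
    real (card (edges G)) \<ge>
      1 / 2 * real (card M) powr (1 - real k / (2 * real k + 1))
        * real (card N) powr (1 - real k / (2 * real k + 1) - 1 / ((2 * real k + 1) * real s))"
proof -
  obtain G :: "nat ugraph" and M N where "bipartite_graph G M N" "card M = q ^ dM"
    "card N = q ^ dN" "graph_free G (subdivision len (complete_bipartite s t))"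
    "1 / 2 * (real q ^ dM * real q ^ dN / real q ^ r) \<le> card (edges G)"
    using assms(1) unfolding dense_free_graph_exists_def by blast
  then show ?thesis
    using assms(2) powr_edge_exponent[of q]
    by (intro exI[of _ G] exI[of _ M] exI[of _ N]) (simp add: len_def powr_realpow mult.assoc)
qed

end

lemma least_common_denominator:
  fixes D :: nat and \<alpha> :: real
  assumes "D > 0" "\<alpha> \<in> \<rat>" "\<alpha> > 0"
    and l: "l = (LEAST m::nat. 0 < m \<and> real m / real D \<in> \<int> \<and> \<alpha> * real m / real D \<in> \<int>)"
  obtains a b where "a > 0" "l = D * a" "\<alpha> * real l = real (D * b)"
proof -
  obtain x y :: int where xy: "y > 0" "\<alpha> = of_int x / of_int y"
    using Rats_cases'[OF assms(2)] by metis
  have "0 < nat y * D \<and> real (nat y * D) / real D \<in> \<int> \<and> \<alpha> * real (nat y * D) / real D \<in> \<int>"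
    using xy assms(1) by auto
  then have "0 < l \<and> real l / real D \<in> \<int> \<and> \<alpha> * real l / real D \<in> \<int>"
    unfolding l by (rule LeastI)
  moreover have "real l / real D \<ge> 0" "\<alpha> * real l / real D \<ge> 0" using assms(3) by auto
  ultimately obtain a b :: nat where ab: "0 < l" "real l / real D = a" "\<alpha> * real l / real D = b"
    by (metis Ints_cases of_int_0_le_iff of_int_of_nat_eq nonneg_int_cases)
  have "real l = real (D * a)" "\<alpha> * real l = real (D * b)"
    using ab(2,3) assms(1) by (simp_all add: field_simps)
  then have "l = D * a" "\<alpha> * real l = real (D * b)" by (simp_all only: of_nat_eq_iff)
  then show ?thesis using that ab(1) by simp
qed

lemma spider_parameters:
  fixes k s l :: nat and \<alpha> :: real
  assumes "s \<ge> 1" and "\<alpha> \<in> \<rat>"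
    and \<alpha>: "\<alpha> \<in> {(real k * real s + 1) / (real k * real s + real s)..1}"
    and l: "l = (LEAST m::nat. 0 < m \<and> real m / ((2 * real k + 1) * real s) \<in> \<int>
                \<and> \<alpha> * real m / ((2 * real k + 1) * real s) \<in> \<int>)"
  obtains a b where "spider k s a b" "l = spider.dN k s a" "\<alpha> * real l = real (spider.dM k s b)"
proof -
  define D where "D = (2 * k + 1) * s"
  have D: "D > 0" "(2 * real k + 1) * real s = real D"
    using assms(1) by (simp_all add: D_def algebra_simps)
  have pos: "0 < real k * real s + real s" using assms(1) by (simp add: add_nonneg_pos)
  have "0 < (real k * real s + 1) / (real k * real s + real s)"
    using pos by (simp add: add_nonneg_pos)
  then have "\<alpha> > 0" using \<alpha> by auto
  then obtain a b where ab: "a > 0" "l = D * a" "\<alpha> * real l = real (D * b)"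
    using least_common_denominator[OF D(1) assms(2) _ l[unfolded D(2)]] by blast
  then have \<alpha>a: "\<alpha> * real a = real b" using D(1) by simp
  have "spider k s a b"
  proof
    show "1 \<le> s" by fact
    show "1 \<le> a" using ab(1) by simp
    have "real b \<le> 1 * real a" unfolding \<alpha>a[symmetric] using \<alpha> by (intro mult_right_mono) auto
    then show "b \<le> a" by simp
    have "real k * real s + 1 \<le> \<alpha> * (real k * real s + real s)"
      using \<alpha> pos by (simp add: pos_divide_le_eq)
    then have "real a * (real k * real s + 1) \<le> real a * (\<alpha> * (real k * real s + real s))"
      by (rule mult_left_mono) simp
    also have "\<dots> = real b * (real k * real s + real s)" by (simp flip: \<alpha>a)
    finally have "real (a * (k * s + 1)) \<le> real (b * ((k + 1) * s))" by (simp add: algebra_simps)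
    then show "a * (k * s + 1) \<le> b * ((k + 1) * s)" by (simp only: of_nat_le_iff)
  qed
  then show ?thesis
    using that ab(2,3) by (simp add: spider.dM_def spider.dN_def spider.len_def D_def)
qed

theorem theorem5p9:
  fixes k s l :: nat and \<alpha> :: real
  assumes "k \<ge> 2" and "s \<ge> 1"
    and "\<alpha> \<in> \<rat>"
    and "\<alpha> \<in> {(real k * real s + 1) / (real k * real s + real s)..1}"
    and "l = (LEAST m::nat. 0 < m \<and> real m / ((2 * real k + 1) * real s) \<in> \<int>
                \<and> \<alpha> * real m / ((2 * real k + 1) * real s) \<in> \<int>)"
  shows "\<exists>t0 q0 :: nat. \<forall>t \<ge> t0. \<forall>q :: nat. q \<ge> q0 \<longrightarrow> primepow q \<longrightarrow>
    (\<exists>(G :: nat ugraph) M N.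
       bipartite_graph G M N \<and>
       real (card M) = real q powr (\<alpha> * real l) \<and>
       card N = q ^ l \<and>
       graph_free G (subdivision (2 * k + 1) (complete_bipartite s t)) \<and>
       real (card (edges G)) \<ge>
         1 / 2 * real (card M) powr (1 - real k / (2 * real k + 1))
               * real (card N) powr (1 - real k / (2 * real k + 1) - 1 / ((2 * real k + 1) * real s)))"
proof -
  obtain a b where "spider k s a b"
    and l: "l = spider.dN k s a" "\<alpha> * real l = real (spider.dM k s b)"
    using spider_parameters[OF assms(2-5)] .
  then interpret spider k s a b by simp
  obtain t0 q0 where graphs: "\<And>t q. t \<ge> t0 \<Longrightarrow> q \<ge> q0 \<Longrightarrow> dense_free_graph_exists t q"
    by (rule eventually_dense_free_graph_exists) (rule that)
  show ?thesis
    unfolding l(2) unfolding l(1)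
    by (intro exI[of _ t0] exI[of _ q0] allI impI dense_free_graph_exists_powr graphs
        primepow_gt_0_nat)
qed

end
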